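(* Let $(X,f)$ be a dynamical system ($X$ compact metric, $f$ continuous) satisfying: (H1) the entropy map $\mu\mapsto h_\mu(f)$ is upper semicontinuous on $\mathcal M_f(X)$; (H2) every Lipschitz potential on $X$ has a unique equilibrium state; (H3) $(X,f)$ has the saturated property for every invariant measure; (H4) there exist two distinct uniquely ergodic measures with zero entropy. Let $m_{\max}$ denote the unique measure of maximal entropy. Then for any two distinct uniquely ergodic measures with zero entropy $\mu_L,\mu_R\in\mathcal M_f(X)$ there exists a weak$^*$ continuous path $\{\nu_t\}_{t\in[-1,1]}\subset\mathcal M_f^e(X)$ with $\nu_{-1}=\mu_L$, $\nu_0=m_{\max}$, $\nu_1=\mu_R$, such that $t\mapsto h_{\nu_t}(f)$ is continuous on $[-1,1]$, nondecreasing on $[-1,0]$ and nonincreasing on $[0,1]$, and $\{\nu_t:t\in[-1,0]\}\cap\{\nu_t:t\in[0,1]\}=\{m_{\max}\}$.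
   Context: $\mathcal M_f(X)$: $f$-invariant Borel probability measures (weak$^*$); $\mathcal M_f^e(X)$: ergodic ones; $h_\mu(f)$ metric entropy. An equilibrium state for $\varphi$ is $\nu$ attaining $\sup_\mu(h_\mu(f)+\int\varphi\,d\mu)$; a measure of maximal entropy is an equilibrium state for $\varphi=0$ (its uniqueness follows from (H2)). $\mu$ is uniquely ergodic if $\mathcal M_f(\operatorname{Supp}\mu)=\{\mu\}$. Saturated property for every invariant measure: for every $\mu$, $G_\mu=\{x:\frac1n\sum_{k<n}\delta_{f^kx}\to\mu\}\ne\emptyset$ and its Bowen topological entropy equals $h_\mu(f)$. *)

theory Defs
  imports "HOL-Analysis.Analysis" "HOL-Probability.Probability"
begin

definition invariant_measures :: "'a::metric_space set \<Rightarrow> ('a \<Rightarrow> 'a) \<Rightarrow> 'a measure set" where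
  "invariant_measures X f =
     {\<mu>. prob_space \<mu> \<and> sets \<mu> = sets (restrict_space borel X) \<and>
          (\<forall>A\<in>sets \<mu>. emeasure \<mu> (f -` A \<inter> X) = emeasure \<mu> A)}"

definition ergodic_measures :: "'a::metric_space set \<Rightarrow> ('a \<Rightarrow> 'a) \<Rightarrow> 'a measure set" where
  "ergodic_measures X f =
     {\<mu>\<in>invariant_measures X f. \<forall>A\<in>sets \<mu>. f -` A \<inter> X = A \<longrightarrow>
          emeasure \<mu> A = 0 \<or> emeasure \<mu> A = 1}"

definition msupp :: "'a::metric_space set \<Rightarrow> 'a measure \<Rightarrow> 'a set" where
  "msupp X \<mu> = {x\<in>X. \<forall>U. open U \<longrightarrow> x \<in> U \<longrightarrow> emeasure \<mu> (U \<inter> X) > 0}"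

text \<open>Uniquely ergodic: the only invariant measure on Supp mu is mu itself
  (invariant measures on Supp mu are identified with invariant measures on X giving
   full mass to Supp mu).\<close>
definition uniquely_ergodic :: "'a::metric_space set \<Rightarrow> ('a \<Rightarrow> 'a) \<Rightarrow> 'a measure \<Rightarrow> bool" where
  "uniquely_ergodic X f \<mu> \<longleftrightarrow> \<mu> \<in> invariant_measures X f \<and>
     (\<forall>\<nu>\<in>invariant_measures X f. emeasure \<nu> (msupp X \<mu>) = 1 \<longrightarrow> \<nu> = \<mu>)"

definition weak_star_conv :: "'a::metric_space set \<Rightarrow> (nat \<Rightarrow> 'a measure) \<Rightarrow> 'a measure \<Rightarrow> bool" where
  "weak_star_conv X \<mu>s \<mu> \<longleftrightarrow>
     (\<forall>g::'a \<Rightarrow> real. continuous_on X g \<longrightarrow>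
        (\<lambda>n. integral\<^sup>L (\<mu>s n) g) \<longlonglongrightarrow> integral\<^sup>L \<mu> g)"

text \<open>Weak-star continuity of a path of measures on a set T of parameters
  (weak-star topology = initial topology of the maps mu |-> integral of g, g in C(X)).\<close>
definition weak_star_continuous_on :: "real set \<Rightarrow> 'a::metric_space set \<Rightarrow> (real \<Rightarrow> 'a measure) \<Rightarrow> bool" where
  "weak_star_continuous_on T X \<nu> \<longleftrightarrow>
     (\<forall>g::'a \<Rightarrow> real. continuous_on X g \<longrightarrow> continuous_on T (\<lambda>t. integral\<^sup>L (\<nu> t) g))"

definition finite_partitions :: "'a::metric_space set \<Rightarrow> 'a measure \<Rightarrow> 'a set set set" where
  "finite_partitions X \<mu> =
     {P. finite P \<and> P \<subseteq> sets \<mu> \<and> \<Union>P = X \<and> disjoint P}"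

definition partition_entropy :: "'a measure \<Rightarrow> 'a set set \<Rightarrow> real" where
  "partition_entropy \<mu> P =
     (\<Sum>A\<in>P. if measure \<mu> A = 0 then 0 else - measure \<mu> A * ln (measure \<mu> A))"

definition iter_join :: "'a set \<Rightarrow> ('a \<Rightarrow> 'a) \<Rightarrow> 'a set set \<Rightarrow> nat \<Rightarrow> 'a set set" where
  "iter_join X f P n =
     {X \<inter> (\<Inter>i<n. (f ^^ i) -` (A i)) | A. \<forall>i<n. A i \<in> P}"

definition entropy_partition :: "'a set \<Rightarrow> ('a \<Rightarrow> 'a) \<Rightarrow> 'a measure \<Rightarrow> 'a set set \<Rightarrow> real" where
  "entropy_partition X f \<mu> P =
     lim (\<lambda>n. partition_entropy \<mu> (iter_join X f P n) / real n)"

definition metric_entropy :: "'a::metric_space set \<Rightarrow> ('a \<Rightarrow> 'a) \<Rightarrow> 'a measure \<Rightarrow> ereal" where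
  "metric_entropy X f \<mu> =
     (SUP P\<in>finite_partitions X \<mu>. ereal (entropy_partition X f \<mu> P))"

definition equilibrium_state ::
  "'a::metric_space set \<Rightarrow> ('a \<Rightarrow> 'a) \<Rightarrow> ('a \<Rightarrow> real) \<Rightarrow> 'a measure \<Rightarrow> bool" where
  "equilibrium_state X f \<phi> \<nu> \<longleftrightarrow> \<nu> \<in> invariant_measures X f \<and>
     metric_entropy X f \<nu> + ereal (integral\<^sup>L \<nu> \<phi>) =
       (SUP \<mu>\<in>invariant_measures X f. metric_entropy X f \<mu> + ereal (integral\<^sup>L \<mu> \<phi>))"

definition measure_of_maximal_entropy :: "'a::metric_space set \<Rightarrow> ('a \<Rightarrow> 'a) \<Rightarrow> 'a measure \<Rightarrow> bool" where
  "measure_of_maximal_entropy X f \<nu> \<longleftrightarrow> equilibrium_state X f (\<lambda>_. 0) \<nu>"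

definition bowen_ball :: "'a::metric_space set \<Rightarrow> ('a \<Rightarrow> 'a) \<Rightarrow> nat \<Rightarrow> 'a \<Rightarrow> real \<Rightarrow> 'a set" where
  "bowen_ball X f n x \<epsilon> = {y\<in>X. \<forall>i<n. dist ((f ^^ i) x) ((f ^^ i) y) < \<epsilon>}"

definition bowen_cover_sum ::
  "'a::metric_space set \<Rightarrow> ('a \<Rightarrow> 'a) \<Rightarrow> 'a set \<Rightarrow> real \<Rightarrow> nat \<Rightarrow> real \<Rightarrow> ennreal" where
  "bowen_cover_sum X f Z s N \<epsilon> =
     (INF C\<in>{C. countable C \<and> (\<forall>(n,x)\<in>C. N \<le> n \<and> x \<in> X) \<and>
                Z \<subseteq> (\<Union>(n,x)\<in>C. bowen_ball X f n x \<epsilon>)}.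
        \<integral>\<^sup>+ p. ennreal (exp (- s * real (fst p))) \<partial>(count_space C))"

definition bowen_measure ::
  "'a::metric_space set \<Rightarrow> ('a \<Rightarrow> 'a) \<Rightarrow> 'a set \<Rightarrow> real \<Rightarrow> real \<Rightarrow> ennreal" where
  "bowen_measure X f Z s \<epsilon> = (SUP N. bowen_cover_sum X f Z s N \<epsilon>)"

definition bowen_entropy_eps :: "'a::metric_space set \<Rightarrow> ('a \<Rightarrow> 'a) \<Rightarrow> 'a set \<Rightarrow> real \<Rightarrow> ereal" where
  "bowen_entropy_eps X f Z \<epsilon> = Inf {ereal s | s. bowen_measure X f Z s \<epsilon> = 0}"

text \<open>h(Z,eps) is nonincreasing in eps, so the limit eps -> 0 is the supremum.\<close>
definition bowen_entropy :: "'a::metric_space set \<Rightarrow> ('a \<Rightarrow> 'a) \<Rightarrow> 'a set \<Rightarrow> ereal" where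
  "bowen_entropy X f Z = (SUP \<epsilon>\<in>{0<..}. bowen_entropy_eps X f Z \<epsilon>)"

definition generic_points :: "'a::metric_space set \<Rightarrow> ('a \<Rightarrow> 'a) \<Rightarrow> 'a measure \<Rightarrow> 'a set" where
  "generic_points X f \<mu> =
     {x\<in>X. \<forall>g::'a \<Rightarrow> real. continuous_on X g \<longrightarrow>
        (\<lambda>n. (\<Sum>k<n. g ((f ^^ k) x)) / real n) \<longlonglongrightarrow> integral\<^sup>L \<mu> g}"

definition saturated :: "'a::metric_space set \<Rightarrow> ('a \<Rightarrow> 'a) \<Rightarrow> bool" where
  "saturated X f \<longleftrightarrow> (\<forall>\<mu>\<in>invariant_measures X f.
     generic_points X f \<mu> \<noteq> {} \<and> bowen_entropy X f (generic_points X f \<mu>) = metric_entropy X f \<mu>)"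

end

theory Submission
  imports Defs
begin

text \<open>Choose a Lipschitz function \<open>g\<close> whose maximum and minimum sets are exactly the supports of
  \<open>\<mu>L\<close> and \<open>\<mu>R\<close> (these are disjoint compact invariant sets), with opposite extreme values. For
  \<open>t \<in> [-1, 1]\<close> let \<open>\<nu> t\<close> be the maximiser of \<open>J t \<mu> = (1 - \<bar>t\<bar>) h(\<mu>) - t \<integral>g d\<mu>\<close> over the invariant measures.
  For \<open>\<bar>t\<bar> < 1\<close> it is the equilibrium state of the Lipschitz potential \<open>- t / (1 - \<bar>t\<bar>) g\<close>; at the ends unique
  ergodicity makes \<open>\<mu>L\<close> and \<open>\<mu>R\<close> the unique maximisers. Uniqueness together with convexity of entropy gives
  ergodicity, uniqueness together with upper semicontinuity and weak-star compactness gives continuity, and comparing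
  \<open>J s\<close> and \<open>J t\<close> at their two maximisers gives monotonicity. If \<open>\<nu> s = \<nu> t\<close> with \<open>s < 0 < t\<close>, the
  combination \<open>t J s + (- s) J t\<close>, in which \<open>g\<close> cancels, shows that this measure has maximal entropy.\<close>

section \<open>Entropy of partitions\<close>

text \<open>The weights in \<open>J t\<close> compactify the inverse temperature:
  \<open>t / (1 - \<bar>t\<bar>)\<close> diverges at the ends, while \<open>J t\<close> stays finite
  and varies continuously with \<open>t\<close>, so one compactness argument covers the ends as
  well. Entropy is extended-real and could be infinite, which would make comparisons of
  \<open>J\<close> meaningless. Uniqueness for the zero potential excludes this: a measure of
  infinite entropy and its midpoint with a zero-entropy measure would be two measures of maximal
  entropy. The supports are disjoint because a nonempty intersection would carry an invariant
  measure (Krylov-Bogolyubov), which unique ergodicity would identify with both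
  \<open>\<mu>L\<close> and \<open>\<mu>R\<close>. Upper semicontinuity gives only half of the
  continuity of entropy along the path. The other half comes from maximality of
  \<open>\<nu> s\<close> tested against the competitor \<open>\<nu> t\<close>, and at the ends from
  nonnegativity of entropy.\<close>

lemma subadditive_average_convergent:
  fixes a :: "nat \<Rightarrow> real"
  assumes sub: "\<And>m n. a (m + n) \<le> a m + a n" and nonneg: "\<And>n. 0 \<le> a n"
  shows "convergent (\<lambda>n. a n / real n)"
proof -
  \<comment> \<open>Fekete's lemma: the averages converge to their infimum, because an almost
    optimal \<open>k\<close> controls every \<open>n = q * k + r\<close> up to one remainder
    term.\<close>
  define L where "L = (INF n\<in>{1..}. a n / real n)"
  have bdd: "bdd_below ((\<lambda>n. a n / real n) ` {1..})"
    by (rule bdd_belowI[of _ 0]) (auto intro!: divide_nonneg_nonneg nonneg)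
  have low: "L \<le> a n / real n" if "1 \<le> n" for n
    unfolding L_def by (rule cINF_lower[OF bdd]) (use that in auto)
  have mult: "a (q * k + r) \<le> real q * a k + a r" for q k r
  proof (induction q)
    case (Suc q)
    have "a (Suc q * k + r) \<le> a k + a (q * k + r)"
      using sub[of k "q * k + r"] by (simp add: add.assoc)
    also have "\<dots> \<le> a k + (real q * a k + a r)" using Suc by simp
    finally show ?case by (simp add: algebra_simps)
  qed simp
  have "(\<lambda>n. a n / real n) \<longlonglongrightarrow> L"
  proof (rule LIMSEQ_I)
    fix e :: real assume e: "0 < e"
    have "\<exists>k\<in>{1..}. a k / real k < L + e / 2"
    proof (rule ccontr)
      assume "\<not> ?thesis"
      then have "L + e / 2 \<le> L" unfolding L_def
        by (intro cINF_greatest) (auto simp: not_less)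
      then show False using e by simp
    qed
    then obtain k where k: "1 \<le> k" "a k / real k < L + e / 2" by auto
    \<comment> \<open>\<open>B\<close> bounds the remainder \<open>a (n mod k)\<close> uniformly in
      \<open>n\<close>, and \<open>N\<close> is chosen so that \<open>B / n\<close> falls below
      \<open>e / 2\<close>.\<close>
    define B where "B = (\<Sum>r<k. a r)"
    obtain N :: nat where N: "2 * B / e < real N" using reals_Archimedean2 by blast
    have "norm (a n / real n - L) < e" if n: "n \<ge> max 1 N" for n
    proof -
      have B: "a (n mod k) \<le> B" unfolding B_def
        by (rule member_le_sum) (use k nonneg in auto)
      have "a n \<le> real (n div k) * a k + B"
        using mult[of "n div k" k "n mod k"] B by simp
      moreover have "real (n div k) * a k \<le> real n * (a k / real k)"
      proof -
        have "real (n div k) * real k \<le> real n"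
          by (metis div_times_less_eq_dividend of_nat_mono of_nat_mult)
        then have "real (n div k) \<le> real n / real k" using k by (simp add: field_simps)
        from mult_right_mono[OF this nonneg[of k]] show ?thesis by simp
      qed
      ultimately have "a n / real n \<le> a k / real k + B / real n"
        using n by (simp add: field_simps)
      moreover have "B / real n < e / 2"
      proof -
        have "2 * B / e < real n" using N n by (smt (verit) max.bounded_iff of_nat_mono)
        then show ?thesis using e n by (simp add: field_simps)
      qed
      moreover have "L \<le> a n / real n" using low n by simp
      ultimately show ?thesis using k(2) unfolding real_norm_def by linarith
    qed
    then show "\<exists>n0. \<forall>n\<ge>n0. norm (a n / real n - L) < e" by blast
  qed
  then show ?thesis by (rule convergentI)
qed

section \<open>The function -x ln x\<close>

definition eta :: "real \<Rightarrow> real" where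
  "eta x = - x * ln x"

lemma eta_0 [simp]: "eta 0 = 0"
  by (simp add: eta_def)

lemma eta_nonneg: "0 \<le> x \<Longrightarrow> x \<le> 1 \<Longrightarrow> 0 \<le> eta x"
  by (cases "x = 0") (auto simp: eta_def mult_nonneg_nonpos)

text \<open>The right-hand side is the tangent of the concave \<open>eta\<close> at
  \<open>z\<close>; the bound is \<open>ln y \<le> y - 1\<close> at \<open>y = z / x\<close>.
  Concavity uses the tangent at a barycentre, subadditivity of partition entropy the tangent at a
  product of measures.\<close>

lemma eta_le_tangent:
  assumes "0 \<le> x" "0 < z"
  shows "eta x \<le> - x * ln z + z - x"
proof (cases "x = 0")
  case False
  then have x: "0 < x" using assms by simp
  have "x * ln (z / x) \<le> x * (z / x - 1)"
    using ln_le_minus_one[of "z / x"] x assms by (intro mult_left_mono) auto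
  then show ?thesis using x assms by (simp add: eta_def ln_div algebra_simps)
qed (use assms in simp)

lemma eta_concave:
  assumes "0 \<le> x" "0 \<le> y" "0 < a" "a < 1"
  shows "a * eta x + (1 - a) * eta y \<le> eta (a * x + (1 - a) * y)"
proof -
  define z where "z = a * x + (1 - a) * y"
  show ?thesis
  proof (cases "z = 0")
    case True
    then have "x = 0" "y = 0" using assms unfolding z_def
      by (smt (verit, best) mult_nonneg_nonneg mult_eq_0_iff)+
    then show ?thesis by simp
  next
    case False
    have z: "0 < z" using assms False unfolding z_def
      by (smt (verit) mult_nonneg_nonneg)
    have "a * eta x + (1 - a) * eta y \<le> a * (- x * ln z + z - x) + (1 - a) * (- y * ln z + z - y)"
      by (intro add_mono mult_left_mono eta_le_tangent) (use assms z in auto)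
    also have "\<dots> = - z * ln z" unfolding z_def by algebra
    finally show ?thesis by (simp add: eta_def z_def)
  qed
qed

text \<open>Replacing \<open>ln x\<close> and \<open>ln y\<close> by \<open>ln (x + y)\<close> only
  lowers the right-hand side. This limits the entropy that can be gained by mixing two
  measures.\<close>

lemma eta_add_le:
  assumes "0 \<le> x" "0 \<le> y"
  shows "eta (x + y) \<le> eta x + eta y"
proof -
  have *: "u * ln u \<le> u * ln (u + v)" if "0 \<le> u" "0 \<le> v" for u v :: real
    by (cases "u = 0") (use that in \<open>auto intro!: mult_left_mono\<close>)
  show ?thesis using *[of x y] *[of y x] assms by (simp add: eta_def algebra_simps)
qed

lemma eta_mult: "0 \<le> x \<Longrightarrow> 0 \<le> y \<Longrightarrow> eta (x * y) = x * eta y + y * eta x"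
  by (cases "x = 0 \<or> y = 0") (auto simp: eta_def ln_mult algebra_simps)

lemma partition_entropy_eta: "partition_entropy \<mu> P = (\<Sum>A\<in>P. eta (measure \<mu> A))"
  unfolding partition_entropy_def by (intro sum.cong) (auto simp: eta_def)

section \<open>Joins and preimages of finite partitions\<close>

definition meet_partition :: "'a set set \<Rightarrow> 'a set set \<Rightarrow> 'a set set" where
  "meet_partition P Q = (\<lambda>(A, B). A \<inter> B) ` (P \<times> Q)"

definition preimage_partition :: "'a set \<Rightarrow> ('a \<Rightarrow> 'a) \<Rightarrow> 'a set set \<Rightarrow> 'a set set" where
  "preimage_partition X g Q = (\<lambda>B. g -` B \<inter> X) ` Q"

lemma finite_partitions_cong: "sets \<mu> = sets \<nu> \<Longrightarrow> finite_partitions X \<mu> = finite_partitions X \<nu>"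
  by (simp add: finite_partitions_def)

lemma meet_partition_in_finite_partitions:
  assumes "P \<in> finite_partitions X \<mu>" "Q \<in> finite_partitions X \<mu>"
  shows "meet_partition P Q \<in> finite_partitions X \<mu>"
proof -
  have "\<Union>(meet_partition P Q) = \<Union>P \<inter> \<Union>Q" by (auto simp: meet_partition_def)
  moreover have "disjoint (meet_partition P Q)"
    using assms unfolding finite_partitions_def meet_partition_def disjoint_def by auto blast+
  moreover have "meet_partition P Q \<subseteq> sets \<mu>"
    using assms unfolding finite_partitions_def meet_partition_def by auto
  ultimately show ?thesis using assms by (simp add: finite_partitions_def meet_partition_def)
qed

lemma preimage_partition_in_finite_partitions:
  assumes "Q \<in> finite_partitions X \<mu>" "g \<in> X \<rightarrow> X" "\<And>B. B \<in> sets \<mu> \<Longrightarrow> g -` B \<inter> X \<in> sets \<mu>"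
  shows "preimage_partition X g Q \<in> finite_partitions X \<mu>"
proof -
  have "\<Union> (preimage_partition X g Q) = g -` (\<Union>Q) \<inter> X"
    by (auto simp: preimage_partition_def)
  also have "\<dots> = X" using assms(1,2) unfolding finite_partitions_def by blast
  finally show ?thesis using assms
    unfolding finite_partitions_def preimage_partition_def disjoint_def by auto blast+
qed

lemma sum_measure_Int_partition:
  fixes M :: "'a::metric_space measure"
  assumes M: "prob_space M" and Q: "Q \<in> finite_partitions (space M) M" and A: "A \<in> sets M"
  shows "(\<Sum>B\<in>Q. measure M (A \<inter> B)) = measure M A"
proof -
  interpret prob_space M by fact
  have "prob (\<Union>B\<in>Q. A \<inter> B) = (\<Sum>B\<in>Q. prob (A \<inter> B))"
    by (rule finite_measure_finite_Union)
      (use Q A in \<open>auto simp: finite_partitions_def disjoint_def disjoint_family_on_def, blast+\<close>)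
  moreover have "(\<Union>B\<in>Q. A \<inter> B) = A"
    using Q sets.sets_into_space[OF A] by (auto simp: finite_partitions_def)
  ultimately show ?thesis by simp
qed

lemma sum_measure_partition:
  fixes M :: "'a::metric_space measure"
  assumes M: "prob_space M" and "Q \<in> finite_partitions (space M) M"
  shows "(\<Sum>B\<in>Q. measure M B) = 1"
proof -
  interpret prob_space M by fact
  have "(\<Sum>B\<in>Q. prob (space M \<inter> B)) = (\<Sum>B\<in>Q. prob B)"
    using assms sets.sets_into_space
    by (intro sum.cong) (auto simp: finite_partitions_def Int_absorb1)
  then show ?thesis using sum_measure_Int_partition[OF M assms(2) sets.top] by (simp add: prob_space)
qed

lemma (in prob_space) partition_entropy_nonneg: "0 \<le> partition_entropy M P"
  unfolding partition_entropy_eta by (intro sum_nonneg eta_nonneg) auto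

text \<open>Nonnegativity of mutual information: \<open>eta\<close> at each
  \<open>prob (A \<inter> B)\<close> lies below its tangent at \<open>prob A * prob B\<close>, the
  value under independence. After summation the two leftover terms are both \<open>1\<close> and
  cancel.\<close>

lemma partition_entropy_meet_le:
  fixes M :: "'a::metric_space measure"
  assumes M: "prob_space M" and P: "P \<in> finite_partitions (space M) M" and Q: "Q \<in> finite_partitions (space M) M"
  shows "partition_entropy M (meet_partition P Q) \<le> partition_entropy M P + partition_entropy M Q"
proof -
  interpret prob_space M by fact
  have fin: "finite P" "finite Q" and sets: "\<And>A. A \<in> P \<Longrightarrow> A \<in> sets M" "\<And>A. A \<in> Q \<Longrightarrow> A \<in> sets M"
    using P Q by (auto simp: finite_partitions_def)
  have "partition_entropy M (meet_partition P Q) = (\<Sum>z\<in>P\<times>Q. eta (prob (fst z \<inter> snd z)))"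
    unfolding partition_entropy_eta meet_partition_def split_def
  proof (rule sum.reindex_nontrivial[unfolded o_def])
    \<comment> \<open>Different pairs may have the same intersection, but disjointness of
      \<open>P\<close> and \<open>Q\<close> makes any repeated set empty, and
      \<open>eta 0 = 0\<close>.\<close>
    fix z z' assume z: "z \<in> P \<times> Q" "z' \<in> P \<times> Q" "z \<noteq> z'"
      and eq: "fst z \<inter> snd z = fst z' \<inter> snd z'"
    have "disjoint P" "disjoint Q" using P Q by (simp_all add: finite_partitions_def)
    moreover have "fst z \<noteq> fst z' \<or> snd z \<noteq> snd z'" using z(3) by (simp add: prod_eq_iff)
    ultimately have "fst z \<inter> fst z' = {} \<or> snd z \<inter> snd z' = {}"
      using disjointD[of P "fst z" "fst z'"] disjointD[of Q "snd z" "snd z'"] z(1,2)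
      by (simp add: mem_Times_iff) blast
    then have "fst z \<inter> snd z = {}" using eq by blast
    then show "eta (prob (fst z \<inter> snd z)) = 0" by simp
  qed (use fin in simp)
  also have "\<dots> = (\<Sum>A\<in>P. \<Sum>B\<in>Q. eta (prob (A \<inter> B)))"
    by (simp add: sum.cartesian_product split_def)
  also have "\<dots> \<le> (\<Sum>A\<in>P. \<Sum>B\<in>Q. prob (A \<inter> B) * (- ln (prob A)) + prob (A \<inter> B) * (- ln (prob B))
      + prob A * prob B - prob (A \<inter> B))"
  proof (intro sum_mono)
    fix A B assume AB: "A \<in> P" "B \<in> Q"
    show "eta (prob (A \<inter> B)) \<le> prob (A \<inter> B) * (- ln (prob A)) + prob (A \<inter> B) * (- ln (prob B))
      + prob A * prob B - prob (A \<inter> B)"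
    proof (cases "prob (A \<inter> B) = 0")
      case False
      moreover have "prob (A \<inter> B) \<le> prob A" "prob (A \<inter> B) \<le> prob B"
        using AB sets by (auto intro!: finite_measure_mono)
      ultimately have pos: "0 < prob A" "0 < prob B"
        using measure_nonneg[of M "A \<inter> B"] by linarith+
      show ?thesis
        using eta_le_tangent[of "prob (A \<inter> B)" "prob A * prob B"] pos
        by (simp add: ln_mult algebra_simps)
    qed simp
  qed
  also have "\<dots> = (\<Sum>A\<in>P. \<Sum>B\<in>Q. prob (A \<inter> B) * (- ln (prob A)))
     + (\<Sum>A\<in>P. \<Sum>B\<in>Q. prob (A \<inter> B) * (- ln (prob B)))
     + (\<Sum>A\<in>P. \<Sum>B\<in>Q. prob A * prob B) - (\<Sum>A\<in>P. \<Sum>B\<in>Q. prob (A \<inter> B))"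
    by (simp only: sum.distrib sum_subtractf)
  also have "(\<Sum>A\<in>P. \<Sum>B\<in>Q. prob (A \<inter> B) * (- ln (prob A))) = partition_entropy M P"
    unfolding partition_entropy_eta
  proof (intro sum.cong refl)
    fix A assume "A \<in> P"
    then show "(\<Sum>B\<in>Q. prob (A \<inter> B) * (- ln (prob A))) = eta (prob A)"
      using sum_measure_Int_partition[OF M Q, of A] sets
      unfolding sum_distrib_right[symmetric] by (simp add: eta_def)
  qed
  also have "(\<Sum>A\<in>P. \<Sum>B\<in>Q. prob (A \<inter> B) * (- ln (prob B))) = partition_entropy M Q"
    unfolding partition_entropy_eta
  proof (subst sum.swap, intro sum.cong refl)
    fix B assume "B \<in> Q"
    then show "(\<Sum>A\<in>P. prob (A \<inter> B) * (- ln (prob B))) = eta (prob B)"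
      using sum_measure_Int_partition[OF M P, of B] sets
      unfolding sum_distrib_right[symmetric] by (simp add: eta_def Int_commute)
  qed
  also have "(\<Sum>A\<in>P. \<Sum>B\<in>Q. prob A * prob B) = 1"
    unfolding sum_distrib_left[symmetric] by (simp add: sum_measure_partition M P Q)
  also have "(\<Sum>A\<in>P. \<Sum>B\<in>Q. prob (A \<inter> B)) = 1"
    using sum_measure_Int_partition[OF M Q] sets sum_measure_partition[OF M P] by simp
  finally show ?thesis by simp
qed

lemma funpow_in: "f ` X \<subseteq> X \<Longrightarrow> x \<in> X \<Longrightarrow> (f ^^ n) x \<in> X"
  by (induction n) auto

text \<open>An itinerary of length \<open>m + n\<close> is one of length \<open>m\<close> followed
  by one of length \<open>n\<close> read from \<open>(f ^^ m) x\<close>. Together with invariance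
  this makes the block entropies subadditive.\<close>

lemma iter_join_add:
  assumes fX: "f ` X \<subseteq> X"
  shows "iter_join X f P (m + n) =
    meet_partition (iter_join X f P m) (preimage_partition X (f ^^ m) (iter_join X f P n))"
proof -
  have fm: "(f ^^ i) ((f ^^ m) x) = (f ^^ (m + i)) x" for i x
    by (metis add.commute comp_apply funpow_add)
  have split: "X \<inter> (\<Inter>i<m+n. (f ^^ i) -` A i) =
    (X \<inter> (\<Inter>i<m. (f ^^ i) -` A i)) \<inter> ((f ^^ m) -` (X \<inter> (\<Inter>i<n. (f ^^ i) -` A (m + i))) \<inter> X)" for A
  proof (intro set_eqI iffI)
    fix x assume x: "x \<in> X \<inter> (\<Inter>i<m+n. (f ^^ i) -` A i)"
    then have "(f ^^ i) x \<in> A i" if "i < m + n" for i using that by blast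
    then show "x \<in> (X \<inter> (\<Inter>i<m. (f ^^ i) -` A i)) \<inter> ((f ^^ m) -` (X \<inter> (\<Inter>i<n. (f ^^ i) -` A (m + i))) \<inter> X)"
      using x funpow_in[OF fX] by (simp add: fm)
  next
    fix x assume x: "x \<in> (X \<inter> (\<Inter>i<m. (f ^^ i) -` A i)) \<inter> ((f ^^ m) -` (X \<inter> (\<Inter>i<n. (f ^^ i) -` A (m + i))) \<inter> X)"
    have "(f ^^ i) x \<in> A i" if "i < m + n" for i
    proof (cases "i < m")
      case False
      then obtain k where k: "i = m + k" by (auto simp: not_less le_iff_add)
      have "(f ^^ k) ((f ^^ m) x) \<in> A (m + k)" using x that k by simp
      then show ?thesis by (simp add: k fm)
    qed (use x in simp)
    then show "x \<in> X \<inter> (\<Inter>i<m+n. (f ^^ i) -` A i)" using x by simp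
  qed
  show ?thesis
  proof (intro subset_antisym subsetI)
    fix S assume "S \<in> iter_join X f P (m + n)"
    then obtain A where A: "\<forall>i<m+n. A i \<in> P" "S = X \<inter> (\<Inter>i<m+n. (f ^^ i) -` A i)"
      unfolding iter_join_def by auto
    have "X \<inter> (\<Inter>i<m. (f ^^ i) -` A i) \<in> iter_join X f P m"
      using A(1) unfolding iter_join_def mem_Collect_eq by (intro exI[of _ A]) simp
    moreover have "X \<inter> (\<Inter>i<n. (f ^^ i) -` A (m + i)) \<in> iter_join X f P n"
      using A(1) unfolding iter_join_def mem_Collect_eq by (intro exI[of _ "\<lambda>i. A (m + i)"]) simp
    ultimately show "S \<in> meet_partition (iter_join X f P m) (preimage_partition X (f ^^ m) (iter_join X f P n))"
      unfolding A(2) split meet_partition_def preimage_partition_def by blast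
  next
    fix S assume "S \<in> meet_partition (iter_join X f P m) (preimage_partition X (f ^^ m) (iter_join X f P n))"
    then obtain A A' where A: "\<forall>i<m. A i \<in> P" "\<forall>i<n. A' i \<in> P"
      "S = (X \<inter> (\<Inter>i<m. (f ^^ i) -` A i)) \<inter> ((f ^^ m) -` (X \<inter> (\<Inter>i<n. (f ^^ i) -` A' i)) \<inter> X)"
      unfolding meet_partition_def preimage_partition_def iter_join_def by blast
    define C where "C i = (if i < m then A i else A' (i - m))" for i
    have "S = X \<inter> (\<Inter>i<m+n. (f ^^ i) -` C i)"
      unfolding split A(3) by (simp add: C_def)
    moreover have "\<forall>i<m+n. C i \<in> P" using A by (auto simp: C_def)
    ultimately show "S \<in> iter_join X f P (m + n)" unfolding iter_join_def by blast
  qed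
qed

lemma iter_join_0: "iter_join X f P 0 = {X}"
  by (auto simp: iter_join_def)

lemma iter_join_1:
  assumes "\<Union>P = X"
  shows "iter_join X f P 1 = P"
proof -
  have "iter_join X f P 1 = (\<lambda>A. X \<inter> A) ` P"
  proof (intro subset_antisym subsetI)
    fix S assume "S \<in> (\<lambda>A. X \<inter> A) ` P"
    then obtain A where "A \<in> P" "S = X \<inter> A" by auto
    then show "S \<in> iter_join X f P 1"
      unfolding iter_join_def by (auto intro!: exI[of _ "\<lambda>_. A"])
  qed (auto simp: iter_join_def)
  also have "\<dots> = (\<lambda>A. A) ` P" using assms by (intro image_cong) auto
  also have "\<dots> = P" by simp
  finally show ?thesis .
qed

section \<open>Invariant measures and their metric entropy\<close>

locale compact_system =
  fixes X :: "'a::metric_space set" and f :: "'a \<Rightarrow> 'a"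
  assumes cpt: "compact X" and fcont: "continuous_on X f" and fX: "f ` X \<subseteq> X"
begin

abbreviation "BX \<equiv> restrict_space borel X"
abbreviation "MX \<equiv> invariant_measures X f"

lemma space_BX [simp]: "space BX = X"
  by (simp add: space_restrict_space)

lemma measurable_f: "f \<in> BX \<rightarrow>\<^sub>M BX"
  by (rule measurable_restrict_space2) (use fX fcont borel_measurable_continuous_on_restrict in auto)

lemma invariantD:
  assumes "\<mu> \<in> MX"
  shows "prob_space \<mu>" "sets \<mu> = sets BX" "space \<mu> = X"
    "\<And>A. A \<in> sets \<mu> \<Longrightarrow> f -` A \<inter> X \<in> sets \<mu>"
    "\<And>A. A \<in> sets \<mu> \<Longrightarrow> emeasure \<mu> (f -` A \<inter> X) = emeasure \<mu> A"
    "\<And>A. A \<in> sets \<mu> \<Longrightarrow> measure \<mu> (f -` A \<inter> X) = measure \<mu> A"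
proof -
  show s: "sets \<mu> = sets BX" using assms by (simp add: invariant_measures_def)
  then show "space \<mu> = X" using sets_eq_imp_space_eq[OF s] by simp
  show "f -` A \<inter> X \<in> sets \<mu>" if "A \<in> sets \<mu>" for A
    using measurable_sets[OF measurable_f, of A] that s by simp
qed (use assms in \<open>auto simp: invariant_measures_def measure_def\<close>)

lemma measurable_continuous_on:
  fixes g :: "'a \<Rightarrow> 'b::topological_space"
  assumes "sets \<mu> = sets BX" "continuous_on X g"
  shows "g \<in> borel_measurable \<mu>"
  using borel_measurable_continuous_on_restrict[OF assms(2)] measurable_cong_sets[OF assms(1) refl] by blast

lemma iterate_invariant:
  assumes \<mu>: "\<mu> \<in> MX" and A: "A \<in> sets \<mu>"
  shows "(f ^^ n) -` A \<inter> X \<in> sets \<mu> \<and> measure \<mu> ((f ^^ n) -` A \<inter> X) = measure \<mu> A"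
proof (induction n)
  case 0
  then show ?case using A sets.sets_into_space[OF A] invariantD(3)[OF \<mu>] by (simp add: Int_absorb2)
next
  case (Suc n)
  have "(f ^^ Suc n) -` A \<inter> X = f -` ((f ^^ n) -` A \<inter> X) \<inter> X"
    using fX by (auto simp: funpow_Suc_right simp del: funpow.simps)
  then show ?case using Suc invariantD(4,6)[OF \<mu>] by (simp only:)
qed

lemma iter_join_in_finite_partitions:
  assumes \<mu>: "\<mu> \<in> MX" and P: "P \<in> finite_partitions X \<mu>"
  shows "iter_join X f P n \<in> finite_partitions X \<mu>"
proof (induction n)
  case 0
  have "X \<in> sets \<mu>" using sets.top[of \<mu>] invariantD(3)[OF \<mu>] by simp
  then show ?case by (simp add: iter_join_0 finite_partitions_def)
next
  case (Suc n)
  have "preimage_partition X f (iter_join X f P n) \<in> finite_partitions X \<mu>"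
    using fX by (intro preimage_partition_in_finite_partitions[OF Suc] invariantD(4)[OF \<mu>]) auto
  moreover have "iter_join X f P 1 = P" using P by (intro iter_join_1) (simp add: finite_partitions_def)
  ultimately show ?case
    using iter_join_add[OF fX, of P 1 n] meet_partition_in_finite_partitions[OF P] by simp
qed

lemma partition_entropy_preimage:
  assumes \<mu>: "\<mu> \<in> MX" and Q: "Q \<in> finite_partitions X \<mu>"
  shows "partition_entropy \<mu> (preimage_partition X (f ^^ n) Q) = partition_entropy \<mu> Q"
proof -
  have "partition_entropy \<mu> (preimage_partition X (f ^^ n) Q) = (\<Sum>B\<in>Q. eta (measure \<mu> ((f ^^ n) -` B \<inter> X)))"
    unfolding partition_entropy_eta preimage_partition_def
  proof (subst sum.reindex_nontrivial)
    \<comment> \<open>Distinct atoms share a preimage only if it is empty, as happens for atoms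
      outside the range of \<open>f ^^ n\<close>.\<close>
    fix B C assume BC: "B \<in> Q" "C \<in> Q" "B \<noteq> C" and eq: "(f ^^ n) -` B \<inter> X = (f ^^ n) -` C \<inter> X"
    have "B \<inter> C = {}" using BC Q by (auto simp: finite_partitions_def disjoint_def)
    then have "(f ^^ n) -` B \<inter> X = {}" using eq by blast
    then show "eta (measure \<mu> ((f ^^ n) -` B \<inter> X)) = 0" by simp
  qed (use Q in \<open>auto simp: finite_partitions_def o_def\<close>)
  also have "\<dots> = partition_entropy \<mu> Q"
    unfolding partition_entropy_eta
    by (intro sum.cong) (use Q iterate_invariant[OF \<mu>] in \<open>auto simp: finite_partitions_def\<close>)
  finally show ?thesis .
qed

text \<open>The \<open>lim\<close> in \<open>entropy_partition\<close> carries information only once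
  convergence is known. Fekete's lemma provides it, since the second factor of the split join has
  the same entropy as an unshifted block.\<close>

lemma entropy_partition_tendsto:
  assumes \<mu>: "\<mu> \<in> MX" and P: "P \<in> finite_partitions X \<mu>"
  shows "(\<lambda>n. partition_entropy \<mu> (iter_join X f P n) / real n) \<longlonglongrightarrow> entropy_partition X f \<mu> P"
proof -
  note it = iter_join_in_finite_partitions[OF \<mu> P]
  have sp: "space \<mu> = X" and pr: "prob_space \<mu>" using invariantD[OF \<mu>] by auto
  have "partition_entropy \<mu> (iter_join X f P (m + n))
    \<le> partition_entropy \<mu> (iter_join X f P m) + partition_entropy \<mu> (iter_join X f P n)" for m n
  proof -
    have "preimage_partition X (f ^^ m) (iter_join X f P n) \<in> finite_partitions X \<mu>"
      using it iterate_invariant[OF \<mu>] funpow_in[OF fX]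
      by (intro preimage_partition_in_finite_partitions) auto
    then show ?thesis
      using partition_entropy_meet_le[OF pr, unfolded sp, OF it[of m]]
      unfolding iter_join_add[OF fX] partition_entropy_preimage[OF \<mu> it, symmetric, of n m] by blast
  qed
  then have "convergent (\<lambda>n. partition_entropy \<mu> (iter_join X f P n) / real n)"
    by (rule subadditive_average_convergent) (rule prob_space.partition_entropy_nonneg[OF pr])
  then show ?thesis unfolding entropy_partition_def convergent_LIMSEQ_iff .
qed

lemma entropy_partition_nonneg:
  assumes "\<mu> \<in> MX" "P \<in> finite_partitions X \<mu>"
  shows "0 \<le> entropy_partition X f \<mu> P"
  by (rule LIMSEQ_le_const[OF entropy_partition_tendsto[OF assms]])
    (auto intro!: divide_nonneg_nonneg prob_space.partition_entropy_nonneg invariantD(1)[OF assms(1)])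

lemma metric_entropy_nonneg:
  assumes "\<mu> \<in> MX"
  shows "0 \<le> metric_entropy X f \<mu>"
proof -
  have "{X} \<in> finite_partitions X \<mu>"
    using sets.top[of \<mu>] invariantD(3)[OF assms] by (simp add: finite_partitions_def)
  then show ?thesis unfolding metric_entropy_def
    by (intro SUP_upper2[of "{X}"]) (auto intro: entropy_partition_nonneg[OF assms])
qed

text \<open>Concavity of \<open>eta\<close> bounds the block entropy of the mixture from below. From
  above it exceeds the average by at most \<open>eta a + eta (1 - a)\<close>, the entropy of
  choosing one of the two measures; this does not depend on \<open>n\<close> and disappears after
  division by \<open>n\<close>.\<close>

lemma entropy_partition_convex_combination:
  assumes \<mu>: "\<mu> \<in> MX" and \<nu>: "\<nu> \<in> MX" and \<rho>: "\<rho> \<in> MX" and a: "0 < a" "a < 1"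
    and comb: "\<And>A. A \<in> sets BX \<Longrightarrow> measure \<mu> A = a * measure \<nu> A + (1 - a) * measure \<rho> A"
    and P: "P \<in> finite_partitions X \<mu>"
  shows "entropy_partition X f \<mu> P = a * entropy_partition X f \<nu> P + (1 - a) * entropy_partition X f \<rho> P"
proof -
  have P': "P \<in> finite_partitions X \<nu>" "P \<in> finite_partitions X \<rho>"
    using P invariantD(2) \<mu> \<nu> \<rho> finite_partitions_cong by metis+
  let ?H = "\<lambda>\<mu> n. partition_entropy \<mu> (iter_join X f P n)"
  have lim: "(\<lambda>n. a * (?H \<nu> n / real n) + (1 - a) * (?H \<rho> n / real n))
     \<longlonglongrightarrow> a * entropy_partition X f \<nu> P + (1 - a) * entropy_partition X f \<rho> P"
    using entropy_partition_tendsto[OF \<nu> P'(1)] entropy_partition_tendsto[OF \<rho> P'(2)]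
    by (intro tendsto_intros)
  have m: "measure \<mu> A = a * measure \<nu> A + (1 - a) * measure \<rho> A" if "A \<in> iter_join X f P n" for A n
    using iter_join_in_finite_partitions[OF \<mu> P, of n] that invariantD(2)[OF \<mu>]
    by (intro comb) (auto simp: finite_partitions_def)
  have lo: "a * ?H \<nu> n + (1 - a) * ?H \<rho> n \<le> ?H \<mu> n" for n
  proof -
    have "a * ?H \<nu> n + (1 - a) * ?H \<rho> n
      = (\<Sum>A\<in>iter_join X f P n. a * eta (measure \<nu> A) + (1 - a) * eta (measure \<rho> A))"
      unfolding partition_entropy_eta by (simp add: sum.distrib sum_distrib_left)
    also have "\<dots> \<le> ?H \<mu> n" unfolding partition_entropy_eta
      by (intro sum_mono) (simp add: m eta_concave a)
    finally show ?thesis .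
  qed
  have up: "?H \<mu> n \<le> a * ?H \<nu> n + (1 - a) * ?H \<rho> n + (eta a + eta (1 - a))" for n
  proof -
    have "?H \<mu> n \<le> (\<Sum>A\<in>iter_join X f P n. a * eta (measure \<nu> A) + (1 - a) * eta (measure \<rho> A)
       + measure \<nu> A * eta a + measure \<rho> A * eta (1 - a))" unfolding partition_entropy_eta
    proof (intro sum_mono)
      fix A assume A: "A \<in> iter_join X f P n"
      show "eta (measure \<mu> A) \<le> a * eta (measure \<nu> A) + (1 - a) * eta (measure \<rho> A)
         + measure \<nu> A * eta a + measure \<rho> A * eta (1 - a)"
        using eta_add_le[of "a * measure \<nu> A" "(1 - a) * measure \<rho> A"] a
        by (simp add: m[OF A] eta_mult)
    qed
    also have "\<dots> = a * ?H \<nu> n + (1 - a) * ?H \<rho> n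
       + (\<Sum>A\<in>iter_join X f P n. measure \<nu> A) * eta a + (\<Sum>A\<in>iter_join X f P n. measure \<rho> A) * eta (1 - a)"
      unfolding partition_entropy_eta by (simp add: sum.distrib sum_distrib_left sum_distrib_right)
    also have "\<dots> = a * ?H \<nu> n + (1 - a) * ?H \<rho> n + (eta a + eta (1 - a))"
      using sum_measure_partition[of \<nu> "iter_join X f P n"] sum_measure_partition[of \<rho> "iter_join X f P n"]
        iter_join_in_finite_partitions[OF \<nu> P'(1)] iter_join_in_finite_partitions[OF \<rho> P'(2)]
        invariantD(1,3)[OF \<nu>] invariantD(1,3)[OF \<rho>] by simp
    finally show ?thesis .
  qed
  have "(\<lambda>n. (eta a + eta (1 - a)) / real n) \<longlonglongrightarrow> 0"
    by (rule lim_const_over_n)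
  from tendsto_add[OF lim this]
  have lim': "(\<lambda>n. a * (?H \<nu> n / real n) + (1 - a) * (?H \<rho> n / real n) + (eta a + eta (1 - a)) / real n)
     \<longlonglongrightarrow> a * entropy_partition X f \<nu> P + (1 - a) * entropy_partition X f \<rho> P" by simp
  show ?thesis
  proof (rule antisym)
    show "entropy_partition X f \<mu> P \<le> a * entropy_partition X f \<nu> P + (1 - a) * entropy_partition X f \<rho> P"
    proof (rule LIMSEQ_le[OF entropy_partition_tendsto[OF \<mu> P] lim'], intro exI allI impI)
      fix n :: nat
      show "?H \<mu> n / real n \<le> a * (?H \<nu> n / real n) + (1 - a) * (?H \<rho> n / real n) + (eta a + eta (1 - a)) / real n"
        using divide_right_mono[OF up[of n], of "real n"] by (simp add: add_divide_distrib)
    qed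
    show "a * entropy_partition X f \<nu> P + (1 - a) * entropy_partition X f \<rho> P \<le> entropy_partition X f \<mu> P"
    proof (rule LIMSEQ_le[OF lim entropy_partition_tendsto[OF \<mu> P]], intro exI allI impI)
      fix n :: nat
      show "a * (?H \<nu> n / real n) + (1 - a) * (?H \<rho> n / real n) \<le> ?H \<mu> n / real n"
        using divide_right_mono[OF lo[of n], of "real n"] by (simp add: add_divide_distrib)
    qed
  qed
qed

text \<open>Each partition satisfies an equality, and taking the two suprema separately can only
  enlarge the right-hand side. This direction is the one that lets a component of a nonergodic
  measure compete with it.\<close>

lemma metric_entropy_convex_combination_le:
  assumes \<mu>: "\<mu> \<in> MX" and \<nu>: "\<nu> \<in> MX" and \<rho>: "\<rho> \<in> MX" and a: "0 < a" "a < 1"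
    and comb: "\<And>A. A \<in> sets BX \<Longrightarrow> measure \<mu> A = a * measure \<nu> A + (1 - a) * measure \<rho> A"
  shows "metric_entropy X f \<mu> \<le> ereal a * metric_entropy X f \<nu> + ereal (1 - a) * metric_entropy X f \<rho>"
  unfolding metric_entropy_def[of X f \<mu>]
proof (rule SUP_least)
  fix P assume P: "P \<in> finite_partitions X \<mu>"
  have P': "P \<in> finite_partitions X \<nu>" "P \<in> finite_partitions X \<rho>"
    using P invariantD(2) \<mu> \<nu> \<rho> finite_partitions_cong by metis+
  have "ereal (entropy_partition X f \<mu> P) =
    ereal a * ereal (entropy_partition X f \<nu> P) + ereal (1 - a) * ereal (entropy_partition X f \<rho> P)"
    using entropy_partition_convex_combination[OF assms P] by simp
  also have "\<dots> \<le> ereal a * metric_entropy X f \<nu> + ereal (1 - a) * metric_entropy X f \<rho>"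
    unfolding metric_entropy_def using a P'
    by (intro add_mono ereal_mult_left_mono SUP_upper) auto
  finally show "ereal (entropy_partition X f \<mu> P) \<le>
    ereal a * metric_entropy X f \<nu> + ereal (1 - a) * metric_entropy X f \<rho>" .
qed

lemma metric_entropy_convex_combination_infinite:
  assumes \<mu>: "\<mu> \<in> MX" and \<nu>: "\<nu> \<in> MX" and \<rho>: "\<rho> \<in> MX" and a: "0 < a" "a < 1"
    and comb: "\<And>A. A \<in> sets BX \<Longrightarrow> measure \<mu> A = a * measure \<nu> A + (1 - a) * measure \<rho> A"
    and inf: "metric_entropy X f \<nu> = \<infinity>"
  shows "metric_entropy X f \<mu> = \<infinity>"
proof -
  have "ereal r \<le> metric_entropy X f \<mu>" for r
  proof -
    have "ereal (r / a) < metric_entropy X f \<nu>" using inf by simp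
    then obtain P where P: "P \<in> finite_partitions X \<nu>" "r / a < entropy_partition X f \<nu> P"
      unfolding metric_entropy_def less_SUP_iff by auto
    have P': "P \<in> finite_partitions X \<mu>" "P \<in> finite_partitions X \<rho>"
      using P invariantD(2) \<mu> \<nu> \<rho> finite_partitions_cong by metis+
    have "r \<le> entropy_partition X f \<mu> P"
      unfolding entropy_partition_convex_combination[OF \<mu> \<nu> \<rho> a comb P'(1), simplified]
      using P(2) a mult_nonneg_nonneg[of "1 - a", OF _ entropy_partition_nonneg[OF \<rho> P'(2)]]
      by (simp add: field_simps)
    then show ?thesis unfolding metric_entropy_def by (intro SUP_upper2[OF P'(1)]) simp
  qed
  then show ?thesis by (rule ereal_top)
qed

section \<open>Weak-star compactness\<close>

lemma integrable_continuous_on: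
  fixes g :: "'a \<Rightarrow> real"
  assumes "prob_space \<mu>" "sets \<mu> = sets BX" "continuous_on X g"
  shows "integrable \<mu> g"
proof -
  interpret prob_space \<mu> by fact
  have sp: "space \<mu> = X" using sets_eq_imp_space_eq[OF assms(2)] by simp
  obtain B where "\<And>x. x \<in> X \<Longrightarrow> norm (g x) \<le> B"
    using compact_imp_bounded[OF compact_continuous_image[OF assms(3) cpt]]
    by (auto simp: bounded_iff)
  then show ?thesis
    by (intro integrable_const_bound[of _ B] AE_I2 measurable_continuous_on assms) (auto simp: sp)
qed

text \<open>The ramps decrease to the indicator of \<open>C\<close>, so dominated convergence
  applies. \<open>C\<close> must be nonempty because \<open>infdist x {} = 0\<close> would make
  every ramp constantly \<open>1\<close>.\<close>

lemma measure_closed_eq_lim: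
  assumes M: "prob_space M" "sets M = sets BX" and C: "closed C" "C \<noteq> {}"
  shows "(\<lambda>k. \<integral>x. max 0 (1 - real k * infdist x C) \<partial>M) \<longlonglongrightarrow> measure M (C \<inter> X)"
proof -
  interpret prob_space M by fact
  have sp: "space M = X" using sets_eq_imp_space_eq[OF M(2)] by simp
  have CX: "C \<inter> X \<in> sets M" using C by (auto simp: M(2) sets_restrict_space)
  have "(\<lambda>k. \<integral>x. max 0 (1 - real k * infdist x C) \<partial>M) \<longlonglongrightarrow> (\<integral>x. indicator (C \<inter> X) x \<partial>M)"
  proof (rule integral_dominated_convergence[where w = "\<lambda>_. 1"])
    show "(\<lambda>x. max 0 (1 - real k * infdist x C)) \<in> borel_measurable M" for k
      by (intro measurable_continuous_on M continuous_intros)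
    show "AE x in M. (\<lambda>k. max 0 (1 - real k * infdist x C)) \<longlonglongrightarrow> indicator (C \<inter> X) x"
    proof (rule AE_I2)
      fix x assume "x \<in> space M"
      then have x: "x \<in> X" by (simp add: sp)
      show "(\<lambda>k. max 0 (1 - real k * infdist x C)) \<longlonglongrightarrow> indicator (C \<inter> X) x"
      proof (cases "x \<in> C")
        case True
        then show ?thesis using x by simp
      next
        case False
        then have d: "0 < infdist x C" using infdist_pos_not_in_closed[OF C] by simp
        obtain N :: nat where N: "1 / infdist x C < real N" using reals_Archimedean2 by blast
        have "eventually (\<lambda>k. max 0 (1 - real k * infdist x C) = 0) sequentially"
        proof (rule eventually_sequentiallyI[of N])
          fix k assume "N \<le> k"
          then have "1 / infdist x C < real k" using N by linarith
          then show "max 0 (1 - real k * infdist x C) = 0" using d by (simp add: field_simps)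
        qed
        then show ?thesis using False by (simp add: tendsto_eventually)
      qed
    qed
    show "AE x in M. norm (max 0 (1 - real k * infdist x C)) \<le> 1" for k
      by (auto intro!: mult_nonneg_nonneg infdist_nonneg)
  qed (use CX in auto)
  then show ?thesis using CX by simp
qed

lemma prob_eqI_continuous:
  assumes M: "prob_space M" "sets M = sets BX" and N: "prob_space N" "sets N = sets BX"
    and eq: "\<And>g :: 'a \<Rightarrow> real. continuous_on X g \<Longrightarrow> integral\<^sup>L M g = integral\<^sup>L N g"
  shows "M = N"
proof -
  interpret M: prob_space M by fact
  interpret N: prob_space N by fact
  have sp: "space M = X" "space N = X" using sets_eq_imp_space_eq[OF M(2)] sets_eq_imp_space_eq[OF N(2)] by simp_all
  have id: "(\<lambda>x. x) \<in> borel_measurable M" "(\<lambda>x. x) \<in> borel_measurable N"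
    using M N by (auto intro!: measurable_continuous_on)
  have eqC: "measure M (C \<inter> X) = measure N (C \<inter> X)" if C: "closed C" for C
  proof (cases "C = {}")
    case False
    have e: "(\<integral>x. max 0 (1 - real k * infdist x C) \<partial>M) = (\<integral>x. max 0 (1 - real k * infdist x C) \<partial>N)" for k
      by (intro eq continuous_intros)
    show ?thesis
      using LIMSEQ_unique[OF measure_closed_eq_lim[OF M C False, unfolded e] measure_closed_eq_lim[OF N C False]] .
  qed simp
  \<comment> \<open>Both measures are moved to the whole type, where the closed sets form an
    intersection-stable generator of \<open>borel\<close>.\<close>
  have eqB: "distr M borel (\<lambda>x. x) = distr N borel (\<lambda>x. x)"
  proof (rule measure_eqI_generator_eq[where E = "Collect closed" and \<Omega> = UNIV and A = "\<lambda>_. UNIV"])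
    show "Int_stable (Collect closed)" by (auto simp: Int_stable_def)
    show "emeasure (distr M borel (\<lambda>x. x)) C = emeasure (distr N borel (\<lambda>x. x)) C" if "C \<in> Collect closed" for C
      using that eqC[of C] by (simp add: emeasure_distr id sp M.emeasure_eq_measure N.emeasure_eq_measure)
    show "sets (distr M borel (\<lambda>x. x)) = sigma_sets UNIV (Collect closed)"
      "sets (distr N borel (\<lambda>x. x)) = sigma_sets UNIV (Collect closed)"
      by (simp_all add: borel_eq_closed)
    show "emeasure (distr M borel (\<lambda>x. x)) UNIV \<noteq> \<infinity>"
      by (simp add: emeasure_distr id M.emeasure_eq_measure)
  qed auto
  show ?thesis
  proof (rule measure_eqI)
    fix A assume "A \<in> sets M"
    then obtain B where B: "B \<in> sets borel" "A = B \<inter> X" by (auto simp: M(2) sets_restrict_space)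
    show "emeasure M A = emeasure N A"
      using arg_cong[OF eqB, of "\<lambda>L. emeasure L B"] B by (simp add: emeasure_distr id sp)
  qed (simp add: M N)
qed

text \<open>The image of \<open>M\<close> under \<open>f\<close> has the same integrals as
  \<open>M\<close>, hence equals it by \<open>prob_eqI_continuous\<close>. In this form invariance
  passes to weak-star limits.\<close>

lemma invariantI_continuous:
  assumes M: "prob_space M" "sets M = sets BX"
    and eq: "\<And>g :: 'a \<Rightarrow> real. continuous_on X g \<Longrightarrow> (\<integral>x. g (f x) \<partial>M) = (\<integral>x. g x \<partial>M)"
  shows "M \<in> MX"
proof -
  interpret prob_space M by fact
  have sp: "space M = X" using sets_eq_imp_space_eq[OF M(2)] by simp
  have fm: "f \<in> M \<rightarrow>\<^sub>M BX" using measurable_f measurable_cong_sets[OF M(2) refl] by blast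
  have "distr M BX f = M"
  proof (rule prob_eqI_continuous)
    show "prob_space (distr M BX f)" by (rule prob_space_distr[OF fm])
    show "integral\<^sup>L (distr M BX f) g = integral\<^sup>L M g" if "continuous_on X g" for g :: "'a \<Rightarrow> real"
      using that by (subst integral_distr[OF fm]) (auto simp: eq intro: measurable_continuous_on)
  qed (use M in auto)
  then have "emeasure M (f -` A \<inter> X) = emeasure M A" if "A \<in> sets M" for A
    using emeasure_distr[OF fm, of A] that by (simp add: sp M)
  then show ?thesis using M by (simp add: invariant_measures_def)
qed

lemma integral_compose_invariant:
  fixes g :: "'a \<Rightarrow> real"
  assumes \<mu>: "\<mu> \<in> MX" and g: "continuous_on X g"
  shows "(\<integral>x. g (f x) \<partial>\<mu>) = (\<integral>x. g x \<partial>\<mu>)"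
proof -
  note I = invariantD[OF \<mu>]
  have fm: "f \<in> \<mu> \<rightarrow>\<^sub>M BX" using measurable_f measurable_cong_sets[OF I(2) refl] by blast
  have "distr \<mu> BX f = \<mu>"
    by (rule measure_eqI) (use I fm in \<open>auto simp: emeasure_distr\<close>)
  then show ?thesis using integral_distr[OF fm, of g] g by (simp add: measurable_continuous_on)
qed

lemma continuous_on_compose_f:
  "continuous_on X g \<Longrightarrow> continuous_on X (\<lambda>x. g (f x))"
  using continuous_on_compose2[OF _ fcont fX] by blast

lemma weak_limit_invariant:
  assumes M: "\<And>n. Ms n \<in> MX" and lim: "weak_star_conv X Ms M" and "prob_space M" "sets M = sets BX"
  shows "M \<in> MX"
proof (rule invariantI_continuous)
  fix g :: "'a \<Rightarrow> real" assume g: "continuous_on X g"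
  have "(\<lambda>n. \<integral>x. g (f x) \<partial>Ms n) \<longlonglongrightarrow> (\<integral>x. g (f x) \<partial>M)"
    using lim continuous_on_compose_f[OF g] by (auto simp: weak_star_conv_def)
  then have "(\<lambda>n. \<integral>x. g x \<partial>Ms n) \<longlonglongrightarrow> (\<integral>x. g (f x) \<partial>M)"
    by (simp add: integral_compose_invariant[OF M g])
  moreover have "(\<lambda>n. \<integral>x. g x \<partial>Ms n) \<longlonglongrightarrow> (\<integral>x. g x \<partial>M)"
    using lim g by (auto simp: weak_star_conv_def)
  ultimately show "(\<integral>x. g (f x) \<partial>M) = (\<integral>x. g x \<partial>M)" by (rule LIMSEQ_unique)
qed fact+

end

section \<open>Coding a compact metric space by real numbers\<close>

lemma sum_quarter_powers_separated:
  fixes c :: "nat \<Rightarrow> real"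
  assumes c: "\<And>j. \<bar>c j\<bar> \<le> 1" and zero: "\<And>j. j < i \<Longrightarrow> c j = 0" and ci: "\<bar>c i\<bar> = 1"
  shows "(1 / 4) ^ i / 2 \<le> \<bar>\<Sum>j. c j * (1 / 4) ^ j\<bar>"
proof -
  have sg: "summable (\<lambda>j. (1 / 4 :: real) ^ j)" by (rule summable_geometric) simp
  have s: "summable (\<lambda>j. c j * (1 / 4) ^ j)"
    by (rule summable_comparison_test'[OF sg, of 0])
      (auto simp: abs_mult intro!: mult_left_le_one_le c)
  have st: "summable (\<lambda>j. c (j + Suc i) * (1 / 4) ^ (j + Suc i))"
    using summable_ignore_initial_segment[OF s] by blast
  have "(\<Sum>j. c j * (1 / 4) ^ j) = (\<Sum>j. c (j + Suc i) * (1 / 4) ^ (j + Suc i)) + (\<Sum>j<Suc i. c j * (1 / 4) ^ j)"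
    by (rule suminf_split_initial_segment[OF s])
  also have "(\<Sum>j<Suc i. c j * (1 / 4) ^ j) = c i * (1 / 4) ^ i"
    using zero by simp
  finally have eq: "(\<Sum>j. c j * (1 / 4) ^ j) = (\<Sum>j. c (j + Suc i) * (1 / 4) ^ (j + Suc i)) + c i * (1 / 4) ^ i" .
  \<comment> \<open>The tail is at most a third of the leading term, so at least half of that term
    survives. In base 2 the tail could cancel it completely.\<close>
  have sb: "(\<lambda>j. (1 / 4 :: real) ^ (j + Suc i)) sums ((1 / 4) ^ Suc i * (4 / 3))"
    using sums_mult[OF geometric_sums[of "1 / 4 :: real"], of "(1 / 4) ^ Suc i"]
    by (simp add: power_add mult.commute)
  have "\<bar>\<Sum>j. c (j + Suc i) * (1 / 4) ^ (j + Suc i)\<bar> \<le> (1 / 4) ^ Suc i * (4 / 3)"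
  proof (rule order_trans)
    show "\<bar>\<Sum>j. c (j + Suc i) * (1 / 4) ^ (j + Suc i)\<bar> \<le> (\<Sum>j. (1 / 4) ^ (j + Suc i))"
      unfolding real_norm_def[symmetric]
      by (rule norm_suminf_le[OF _ sums_summable[OF sb]])
        (auto simp: abs_mult simp del: power_Suc add_Suc_right intro!: mult_left_le_one_le c)
  qed (use sums_unique[OF sb] in simp)
  moreover have "\<bar>c i * (1 / 4) ^ i\<bar> = (1 / 4) ^ i" by (simp add: abs_mult ci)
  moreover have "(1 / 4 :: real) ^ Suc i * (4 / 3) = (1 / 4) ^ i / 3" by simp
  moreover have "0 \<le> (1 / 4 :: real) ^ i" by simp
  ultimately show ?thesis unfolding eq by linarith
qed

text \<open>A Borel code \<open>s x = \<Sum>i. 4\<^sup>-\<^sup>i 1\<^bsub>U i\<^esub>(x)\<close> whose inverse is uniformly continuous. It transports sequences of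
  measures on \<open>X\<close> to the real line, where Helly's selection theorem is available.\<close>

lemma compact_metric_coding:
  fixes X :: "'a::metric_space set"
  assumes cpt: "compact X"
  obtains s :: "'a \<Rightarrow> real" where "s \<in> borel_measurable borel" "\<And>x. s x \<in> {0..2}"
    "\<And>e. 0 < e \<Longrightarrow> \<exists>\<delta>>0. \<forall>x\<in>X. \<forall>y\<in>X. \<bar>s x - s y\<bar> < \<delta> \<longrightarrow> dist x y < e"
proof -
  have "\<exists>F. finite F \<and> F \<subseteq> X \<and> X \<subseteq> (\<Union>x\<in>F. ball x (1 / real (Suc k)))" for k
  proof -
    have "X \<subseteq> (\<Union>x\<in>X. ball x (1 / real (Suc k)))" by force
    from compactE_image[OF cpt _ this] show ?thesis by (metis open_ball)
  qed
  then obtain F where F: "\<And>k. finite (F k)" "\<And>k. X \<subseteq> (\<Union>x\<in>F k. ball x (1 / real (Suc k)))" by metis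
  \<comment> \<open>The balls of all finite \<open>1 / (k + 1)\<close>-nets. Inserting
    \<open>{}\<close> keeps the family nonempty, so that \<open>from_nat_into\<close> enumerates it
    even for empty \<open>X\<close>.\<close>
  define \<U> where "\<U> = insert {} (\<Union>k. (\<lambda>x. ball x (1 / real (Suc k))) ` F k)"
  have "countable \<U>" unfolding \<U>_def using F(1)
    by (intro countable_insert countable_UN countable_image) (auto simp: countable_finite)
  then have U: "range (from_nat_into \<U>) = \<U>" by (intro range_from_nat_into) (auto simp: \<U>_def)
  define U where "U = from_nat_into \<U>"
  note U = U[folded U_def]
  have openU: "open (U i)" for i
  proof -
    have "U i \<in> \<U>" using U by auto
    then show ?thesis by (auto simp: \<U>_def)
  qed
  \<comment> \<open>Finitely many memberships locate a point up to \<open>2 / (k + 1)\<close>,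
    because they reveal a ball of the \<open>k\<close>-th net that contains it.\<close>
  have fine: "\<exists>N. \<forall>x\<in>X. \<forall>y\<in>X. (\<forall>i<N. x \<in> U i \<longleftrightarrow> y \<in> U i) \<longrightarrow> dist x y < 2 / real (Suc k)" for k
  proof -
    have "\<forall>z\<in>F k. \<exists>i. U i = ball z (1 / real (Suc k))"
    proof
      fix z assume "z \<in> F k"
      then have "ball z (1 / real (Suc k)) \<in> range U" unfolding U \<U>_def by auto
      then show "\<exists>i. U i = ball z (1 / real (Suc k))" by (metis imageE)
    qed
    then obtain ix where ix: "\<And>z. z \<in> F k \<Longrightarrow> U (ix z) = ball z (1 / real (Suc k))" by metis
    define N where "N = Suc (Max (ix ` F k))"
    have lt: "ix z < N" if "z \<in> F k" for z
      unfolding N_def using that F(1)[of k] by (simp add: less_Suc_eq_le)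
    have "dist x y < 2 / real (Suc k)" if xy: "x \<in> X" "y \<in> X" and same: "\<forall>i<N. x \<in> U i \<longleftrightarrow> y \<in> U i" for x y
    proof -
      obtain z where z: "z \<in> F k" "x \<in> ball z (1 / real (Suc k))" using F(2)[of k] xy by blast
      then have "y \<in> ball z (1 / real (Suc k))" using same lt ix by blast
      then show ?thesis using z dist_triangle2[of x y z]
        by (simp add: dist_commute)
    qed
    then show ?thesis by blast
  qed
  define s where "s x = (\<Sum>i. indicator (U i) x * (1 / 4 :: real) ^ i)" for x
  have sg: "summable (\<lambda>j. (1 / 4 :: real) ^ j)" by (rule summable_geometric) simp
  have sm: "summable (\<lambda>i. indicator (U i) x * (1 / 4 :: real) ^ i)" for x
    by (rule summable_comparison_test'[OF sg, of 0]) (auto simp: indicator_def)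
  show thesis
  proof
    have [measurable]: "U i \<in> sets borel" for i by (intro borel_open openU)
    show "s \<in> borel_measurable borel" unfolding s_def by measurable
    show "s x \<in> {0..2}" for x
    proof -
      have "0 \<le> s x" unfolding s_def by (intro suminf_nonneg sm) simp
      moreover have "s x \<le> (\<Sum>i. (1 / 4 :: real) ^ i)" unfolding s_def
        by (intro suminf_le sm sg) (auto simp: indicator_def)
      moreover have "(\<Sum>i. (1 / 4 :: real) ^ i) \<le> 2" by (subst suminf_geometric) auto
      ultimately show ?thesis by simp
    qed
    fix e :: real assume "0 < e"
    then obtain k where k: "2 / e < real k" using reals_Archimedean2 by blast
    obtain N where N: "\<And>x y. x \<in> X \<Longrightarrow> y \<in> X \<Longrightarrow> (\<forall>i<N. x \<in> U i \<longleftrightarrow> y \<in> U i) \<Longrightarrow> dist x y < 2 / real (Suc k)"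
      using fine[of k] by blast
    \<comment> \<open>If the memberships first differed at some \<open>i < N\<close>, the codes
      would be at least \<open>(1 / 4) ^ i / 2\<close> apart, more than the assumed closeness
      allows.\<close>
    have "dist x y < e" if xy: "x \<in> X" "y \<in> X" and close: "\<bar>s x - s y\<bar> < (1 / 4) ^ N / 2" for x y
    proof -
      have "\<forall>i<N. x \<in> U i \<longleftrightarrow> y \<in> U i"
      proof (rule ccontr)
        assume "\<not> ?thesis"
        then obtain j where j: "j < N" "(x \<in> U j) \<noteq> (y \<in> U j)" by blast
        define i where "i = (LEAST i. (x \<in> U i) \<noteq> (y \<in> U i))"
        have i: "(x \<in> U i) \<noteq> (y \<in> U i)" unfolding i_def using j(2) by (rule LeastI)
        have iN: "i < N"
          unfolding i_def using Least_le[of "\<lambda>i. (x \<in> U i) \<noteq> (y \<in> U i)" j] j by simp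
        have min: "(x \<in> U l) = (y \<in> U l)" if "l < i" for l
          using not_less_Least[of l "\<lambda>i. (x \<in> U i) \<noteq> (y \<in> U i)"] that unfolding i_def by simp
        have "s x - s y = (\<Sum>i. (indicator (U i) x - indicator (U i) y) * (1 / 4) ^ i)"
          unfolding s_def by (subst suminf_diff[OF sm sm]) (simp add: left_diff_distrib)
        moreover have "(1 / 4) ^ i / 2 \<le> \<bar>\<Sum>i. (indicator (U i) x - indicator (U i) y) * (1 / 4 :: real) ^ i\<bar>"
          by (rule sum_quarter_powers_separated) (use i min in \<open>auto simp: indicator_def\<close>)
        moreover have "(1 / 4 :: real) ^ N \<le> (1 / 4) ^ i" using iN by (intro power_decreasing) auto
        ultimately show False using close by linarith
      qed
      then have "dist x y < 2 / real (Suc k)" using N xy by blast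
      also have "\<dots> \<le> e" using k \<open>0 < e\<close> by (simp add: field_simps)
      finally show ?thesis .
    qed
    then show "\<exists>\<delta>>0. \<forall>x\<in>X. \<forall>y\<in>X. \<bar>s x - s y\<bar> < \<delta> \<longrightarrow> dist x y < e"
      by (intro exI[of _ "(1 / 4) ^ N / 2"]) auto
  qed
qed

text \<open>The inverse of the coding is uniformly continuous, so it extends to the closure, and
  compactness keeps the values in \<open>X\<close>. The closure is unavoidable: a weak limit of
  measures on \<open>s\<close> X\<open>may charge codes outside\<close>s \<open>X\<close>.\<close>

lemma coding_inverse_extension:
  fixes X :: "'a::metric_space set" and s :: "'a \<Rightarrow> real"
  assumes cpt: "compact X"
    and s: "\<And>e. 0 < e \<Longrightarrow> \<exists>\<delta>>0. \<forall>x\<in>X. \<forall>y\<in>X. \<bar>s x - s y\<bar> < \<delta> \<longrightarrow> dist x y < e"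
  obtains \<pi> where "continuous_on (closure (s ` X)) \<pi>" "\<pi> ` closure (s ` X) \<subseteq> X"
    "\<And>x. x \<in> X \<Longrightarrow> \<pi> (s x) = x"
proof -
  have "\<exists>x\<in>X. \<exists>u. (\<forall>n. u n \<in> X) \<and> (\<lambda>n. s (u n)) \<longlonglongrightarrow> y \<and> u \<longlonglongrightarrow> x" if y: "y \<in> closure (s ` X)" for y
  proof -
    obtain v where v: "\<And>n. v n \<in> s ` X" "v \<longlonglongrightarrow> y" using y unfolding closure_sequential by blast
    define u where "u n = inv_into X s (v n)" for n
    have u: "u n \<in> X" "v n = s (u n)" for n
      using v(1)[of n] by (auto simp: u_def inv_into_into f_inv_into_f)
    obtain x r where x: "x \<in> X" "strict_mono r" "(u \<circ> r) \<longlonglongrightarrow> x"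
      using cpt u(1) unfolding compact_def by blast
    have "(\<lambda>n. s ((u \<circ> r) n)) \<longlonglongrightarrow> y"
      using LIMSEQ_subseq_LIMSEQ[OF v(2) x(2)] by (simp add: o_def u(2))
    then show ?thesis using x u by (intro bexI[of _ x] exI[of _ "u \<circ> r"]) auto
  qed
  then obtain \<pi> u where \<pi>: "\<And>y. y \<in> closure (s ` X) \<Longrightarrow> \<pi> y \<in> X"
    and u: "\<And>y n. y \<in> closure (s ` X) \<Longrightarrow> u y n \<in> X"
      "\<And>y. y \<in> closure (s ` X) \<Longrightarrow> (\<lambda>n. s (u y n)) \<longlonglongrightarrow> y"
      "\<And>y. y \<in> closure (s ` X) \<Longrightarrow> u y \<longlonglongrightarrow> \<pi> y"
    by metis
  \<comment> \<open>Comparing \<open>\<pi> y\<close> with the limit of any sequence whose codes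
    converge serves two purposes: the sequence \<open>u y\<close> gives continuity, a constant
    sequence gives \<open>\<pi> (s x) = x\<close>.\<close>
  have modulus: "\<exists>\<delta>>0. \<forall>y\<in>closure (s ` X). \<forall>v l z. (\<forall>n. v n \<in> X) \<longrightarrow> (\<lambda>n. s (v n)) \<longlonglongrightarrow> z \<longrightarrow> v \<longlonglongrightarrow> l
      \<longrightarrow> \<bar>y - z\<bar> < \<delta> \<longrightarrow> dist (\<pi> y) l \<le> e" if "0 < e" for e
  proof -
    obtain \<delta> where \<delta>: "0 < \<delta>" "\<And>x y. x \<in> X \<Longrightarrow> y \<in> X \<Longrightarrow> \<bar>s x - s y\<bar> < \<delta> \<Longrightarrow> dist x y < e"
      using s[OF \<open>0 < e\<close>] by blast
    have "dist (\<pi> y) l \<le> e" if y: "y \<in> closure (s ` X)" and v: "\<forall>n. v n \<in> X" "(\<lambda>n. s (v n)) \<longlonglongrightarrow> z" "v \<longlonglongrightarrow> l"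
      and yz: "\<bar>y - z\<bar> < \<delta>" for y v l z
    proof -
      have "(\<lambda>n. \<bar>s (u y n) - s (v n)\<bar>) \<longlonglongrightarrow> \<bar>y - z\<bar>"
        by (intro tendsto_intros u v y)
      then have "eventually (\<lambda>n. \<bar>s (u y n) - s (v n)\<bar> < \<delta>) sequentially"
        using yz by (rule order_tendstoD)
      then have "eventually (\<lambda>n. dist (u y n) (v n) \<le> e) sequentially"
        by (rule eventually_mono) (use \<delta>(2) u(1)[OF y] v(1) in \<open>auto intro: less_imp_le\<close>)
      moreover have "(\<lambda>n. dist (u y n) (v n)) \<longlonglongrightarrow> dist (\<pi> y) l"
        by (intro tendsto_intros u v y)
      ultimately show ?thesis
        using tendsto_upperbound[OF _ _ sequentially_bot] by blast
    qed
    then show ?thesis using \<delta>(1) by blast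
  qed
  show thesis
  proof
    show "\<pi> ` closure (s ` X) \<subseteq> X" using \<pi> by auto
    show "continuous_on (closure (s ` X)) \<pi>"
      unfolding continuous_on_iff
    proof (intro ballI allI impI)
      fix y e assume y: "y \<in> closure (s ` X)" and e: "(0::real) < e"
      obtain \<delta> where \<delta>: "0 < \<delta>" and m: "\<forall>y\<in>closure (s ` X). \<forall>v l z. (\<forall>n. v n \<in> X) \<longrightarrow> (\<lambda>n. s (v n)) \<longlonglongrightarrow> z \<longrightarrow> v \<longlonglongrightarrow> l
          \<longrightarrow> \<bar>y - z\<bar> < \<delta> \<longrightarrow> dist (\<pi> y) l \<le> e / 2"
        using modulus[of "e / 2"] e by auto
      have "dist (\<pi> y') (\<pi> y) < e" if "y' \<in> closure (s ` X)" "dist y' y < \<delta>" for y'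
      proof -
        have "dist (\<pi> y') (\<pi> y) \<le> e / 2"
          using m that u[OF y] unfolding dist_real_def by blast
        then show ?thesis using e by simp
      qed
      then show "\<exists>d>0. \<forall>x'\<in>closure (s ` X). dist x' y < d \<longrightarrow> dist (\<pi> x') (\<pi> y) < e"
        using \<delta> by blast
    qed
    show "\<pi> (s x) = x" if x: "x \<in> X" for x
    proof -
      have "dist (\<pi> (s x)) x \<le> e" if "0 < e" for e
      proof -
        obtain \<delta> where \<delta>: "0 < \<delta>" and m: "\<forall>y\<in>closure (s ` X). \<forall>v l z. (\<forall>n. v n \<in> X) \<longrightarrow> (\<lambda>n. s (v n)) \<longlonglongrightarrow> z \<longrightarrow> v \<longlonglongrightarrow> l
            \<longrightarrow> \<bar>y - z\<bar> < \<delta> \<longrightarrow> dist (\<pi> y) l \<le> e"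
          using modulus[OF \<open>0 < e\<close>] by blast
        have "s x \<in> closure (s ` X)" by (rule subsetD[OF closure_subset imageI[OF x]])
        from m[rule_format, OF this, of "\<lambda>_. x" "s x" x] show ?thesis using x \<delta> by simp
      qed
      then have "dist (\<pi> (s x)) x \<le> 0" using field_le_epsilon[of "dist (\<pi> (s x)) x" 0] by simp
      then show ?thesis by simp
    qed
  qed
qed

section \<open>Sequential compactness and existence of invariant measures\<close>

context compact_system
begin

lemma emeasure_eq_1_if_infdist_integral_0:
  assumes \<mu>: "prob_space \<mu>" "sets \<mu> = sets BX" and K: "closed K" "K \<noteq> {}" "K \<subseteq> X"
    and int: "(\<integral>x. infdist x K \<partial>\<mu>) = 0"
  shows "emeasure \<mu> K = 1"
proof -
  interpret prob_space \<mu> by fact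
  have "integrable \<mu> (\<lambda>x. infdist x K)"
    by (intro integrable_continuous_on \<mu> continuous_intros)
  then have "AE x in \<mu>. infdist x K = 0"
    using int by (subst (asm) integral_nonneg_eq_0_iff_AE) (auto intro: infdist_nonneg)
  then have "AE x in \<mu>. x \<in> K"
    by eventually_elim (use in_closed_iff_infdist_zero[OF K(1,2)] in auto)
  moreover have "K \<in> sets \<mu>" using K by (auto simp: \<mu>(2) sets_restrict_space intro!: image_eqI[of _ _ K])
  ultimately show ?thesis using emeasure_eq_1_AE by blast
qed

text \<open>The images under the coding live on a bounded interval, hence are tight and have a
  weakly convergent subsequence. Its limit is carried by the closure of the codes and is pulled back
  to \<open>X\<close> by \<open>\<pi>\<close>.\<close>

theorem weak_star_subsequence:
  fixes Ms :: "nat \<Rightarrow> 'a measure"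
  assumes M: "\<And>n. prob_space (Ms n)" "\<And>n. sets (Ms n) = sets BX"
  obtains r M where "strict_mono r" "prob_space M" "sets M = sets BX" "weak_star_conv X (Ms \<circ> r) M"
proof -
  have sp: "space (Ms n) = X" for n using sets_eq_imp_space_eq[OF M(2)] by simp
  have "X \<noteq> {}" using prob_space.not_empty[OF M(1)[of 0]] sp by simp
  then obtain x0 where x0: "x0 \<in> X" by blast
  obtain s :: "'a \<Rightarrow> real" where s: "s \<in> borel_measurable borel" "\<And>x. s x \<in> {0..2}"
    "\<And>e. 0 < e \<Longrightarrow> \<exists>\<delta>>0. \<forall>x\<in>X. \<forall>y\<in>X. \<bar>s x - s y\<bar> < \<delta> \<longrightarrow> dist x y < e"
    using compact_metric_coding[OF cpt] by blast
  define K where "K = closure (s ` X)"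
  obtain \<pi> where \<pi>: "continuous_on K \<pi>" "\<pi> ` K \<subseteq> X" "\<And>x. x \<in> X \<Longrightarrow> \<pi> (s x) = x"
    using coding_inverse_extension[OF cpt s(3)] unfolding K_def by blast
  have sK: "s x \<in> K" if "x \<in> X" for x
    unfolding K_def by (rule subsetD[OF closure_subset imageI[OF that]])
  have K: "closed K" "K \<noteq> {}" using sK[OF x0] by (auto simp: K_def)
  have sm: "s \<in> borel_measurable (Ms n)" for n
    using measurable_restrict_space1[OF s(1), of X] measurable_cong_sets[OF M(2) refl] by blast
  define L where "L n = distr (Ms n) borel s" for n
  have L: "real_distribution (L n)" for n
    unfolding L_def by (intro real_distribution.intro real_distribution_axioms.intro prob_space.prob_space_distr M sm) simp
  have intL: "integral\<^sup>L (L n) h = (\<integral>x. h (s x) \<partial>Ms n)" if "continuous_on UNIV h" for h :: "real \<Rightarrow> real" and n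
    unfolding L_def using that by (intro integral_distr sm borel_measurable_continuous_onI)
  have "tight L"
    unfolding tight_def
  proof (intro conjI allI impI)
    fix e :: real assume "0 < e"
    \<comment> \<open>The left end lies below \<open>0\<close> because the interval is open there
      and \<open>0\<close> is an admissible value of \<open>s\<close>.\<close>
    have "measure (L n) {-1<..2} = 1" for n
    proof -
      have "-1 < s x \<and> s x \<le> 2" for x
        using s(2)[of x] by simp
      then have "s -` {-1<..2} \<inter> space (Ms n) = space (Ms n)" by auto
      then show ?thesis using prob_space.prob_space[OF M(1)] by (simp add: L_def measure_distr sm)
    qed
    then show "\<exists>a b. a < b \<and> (\<forall>n. 1 - e < measure (L n) {a<..b})"
      using \<open>0 < e\<close> by (intro exI[of _ "-1"] exI[of _ 2]) simp
  qed (rule L)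
  then obtain r Q where r: "strict_mono r" and Q: "real_distribution Q" and conv: "weak_conv_m (L \<circ> id \<circ> r) Q"
    using tight_imp_convergent_subsubsequence[of L id] by (auto simp: strict_mono_def)
  interpret Q: real_distribution Q by (rule Q)
  have Qm: "h \<in> borel_measurable Q" if "continuous_on UNIV h" for h :: "real \<Rightarrow> real"
    using borel_measurable_continuous_onI[OF that] by simp
  have limQ: "(\<lambda>n. \<integral>x. h (s x) \<partial>Ms (r n)) \<longlonglongrightarrow> integral\<^sup>L Q h"
    if h: "continuous_on UNIV h" "\<And>x. norm (h x) \<le> B" for h :: "real \<Rightarrow> real" and B
  proof -
    have "(\<lambda>n. integral\<^sup>L ((L \<circ> id \<circ> r) n) h) \<longlonglongrightarrow> integral\<^sup>L Q h"
      using h by (intro weak_conv_imp_integral_bdd_continuous_conv[OF _ Q conv])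
        (auto simp: L continuous_on_eq_continuous_at)
    then show ?thesis by (simp add: intL h)
  qed
  \<comment> \<open>A bounded continuous function vanishing exactly on \<open>K\<close> has integral
    \<open>0\<close> along the sequence, hence in the limit. The \<open>min 1\<close> provides the
    boundedness.\<close>
  have AEK: "AE y in Q. y \<in> K"
  proof -
    define h where "h y = min 1 (infdist y K)" for y :: real
    have h: "continuous_on UNIV h" "\<And>y. norm (h y) \<le> 1" "\<And>y. 0 \<le> h y"
      unfolding h_def by (auto intro!: continuous_intros simp: infdist_nonneg)
    have "(\<integral>x. h (s x) \<partial>Ms n) = 0" for n
    proof -
      have "(\<integral>x. h (s x) \<partial>Ms n) = (\<integral>x. 0 \<partial>Ms n)"
        by (rule Bochner_Integration.integral_cong) (auto simp: h_def sp sK)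
      then show ?thesis by simp
    qed
    then have "integral\<^sup>L Q h = 0" using limQ[OF h(1,2)] by (simp add: LIMSEQ_const_iff)
    moreover have "integrable Q h"
      using h by (intro Q.integrable_const_bound[of _ 1] Qm) auto
    ultimately have "AE y in Q. h y = 0" using h(3) by (subst (asm) integral_nonneg_eq_0_iff_AE) auto
    then show ?thesis
      by eventually_elim (use in_closed_iff_infdist_zero[OF K] in \<open>auto simp: h_def min_def split: if_splits\<close>)
  qed
  \<comment> \<open>Off \<open>K\<close>, a null set for \<open>Q\<close>, the point
    \<open>x0\<close> is a placeholder that makes \<open>\<rho>\<close> a Borel map into
    \<open>X\<close>.\<close>
  define \<rho> where "\<rho> y = (if y \<in> K then \<pi> y else x0)" for y
  have \<rho>: "\<rho> \<in> Q \<rightarrow>\<^sub>M BX"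
  proof (rule measurable_restrict_space2)
    have "\<pi> \<in> borel_measurable (restrict_space Q K)"
      using borel_measurable_continuous_on_restrict[OF \<pi>(1)]
      unfolding measurable_cong_sets[OF sets_restrict_space_cong[OF Q.events_eq_borel] refl] .
    then show "\<rho> \<in> borel_measurable Q"
      unfolding \<rho>_def using K by (subst (asm) measurable_restrict_space_iff[where c = x0]) auto
  qed (use \<pi>(2) x0 in \<open>auto simp: \<rho>_def image_subset_iff\<close>)
  define M where "M = distr Q BX \<rho>"
  have "weak_star_conv X (Ms \<circ> r) M"
    unfolding weak_star_conv_def
  proof (intro allI impI)
    fix g :: "'a \<Rightarrow> real" assume g: "continuous_on X g"
    obtain B where B: "\<And>x. x \<in> X \<Longrightarrow> norm (g x) \<le> B" "0 \<le> B"
    proof -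
      obtain B where "\<And>x. x \<in> X \<Longrightarrow> norm (g x) \<le> B"
        using compact_imp_bounded[OF compact_continuous_image[OF g cpt]] by (auto simp: bounded_iff)
      then show thesis using that[of "\<bar>B\<bar>"] by fastforce
    qed
    have "continuous_on K (\<lambda>y. g (\<pi> y))"
      using continuous_on_compose2[OF g \<pi>(1,2)] .
    \<comment> \<open>Tietze's theorem turns \<open>g\<close> composed with \<open>\<pi>\<close>
      into a bounded continuous test function on the line. Since \<open>G (s x) = g x\<close> on
      \<open>X\<close>, it tests \<open>Ms (r n)\<close> although \<open>s\<close> itself is only
      Borel.\<close>
    then obtain G where G: "continuous_on UNIV G" "\<And>y. y \<in> K \<Longrightarrow> G y = g (\<pi> y)" "\<And>y. norm (G y) \<le> B"
      using Tietze[of K "\<lambda>y. g (\<pi> y)" UNIV B] B K(1) \<pi>(2) by (auto simp: image_subset_iff)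
    have "(\<lambda>n. \<integral>x. G (s x) \<partial>Ms (r n)) \<longlonglongrightarrow> integral\<^sup>L Q G" using limQ[OF G(1,3)] .
    moreover have "(\<integral>x. G (s x) \<partial>Ms (r n)) = (\<integral>x. g x \<partial>Ms (r n))" for n
      by (rule Bochner_Integration.integral_cong) (auto simp: sp G(2) sK \<pi>(3))
    moreover have "integral\<^sup>L Q G = (\<integral>y. g (\<rho> y) \<partial>Q)"
    proof (rule integral_cong_AE[OF Qm[OF G(1)]])
      show "(\<lambda>y. g (\<rho> y)) \<in> borel_measurable Q"
        using measurable_compose[OF \<rho> borel_measurable_continuous_on_restrict[OF g]] .
      show "AE y in Q. G y = g (\<rho> y)"
        using AEK by eventually_elim (simp add: \<rho>_def G(2))
    qed
    moreover have "(\<integral>y. g (\<rho> y) \<partial>Q) = integral\<^sup>L M g"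
      unfolding M_def using borel_measurable_continuous_on_restrict[OF g]
      by (intro integral_distr[symmetric] \<rho>)
    ultimately show "(\<lambda>n. integral\<^sup>L ((Ms \<circ> r) n) g) \<longlonglongrightarrow> integral\<^sup>L M g" by simp
  qed
  moreover have "prob_space M" unfolding M_def by (rule Q.prob_space_distr[OF \<rho>])
  ultimately show thesis using r by (intro that[of r M]) (auto simp: M_def)
qed

corollary invariant_measures_weak_star_subsequence:
  fixes Ms :: "nat \<Rightarrow> 'a measure"
  assumes "\<And>n. Ms n \<in> MX"
  obtains r M where "strict_mono r" "M \<in> MX" "weak_star_conv X (Ms \<circ> r) M"
proof -
  obtain r M where r: "strict_mono r" "prob_space M" "sets M = sets BX" "weak_star_conv X (Ms \<circ> r) M"
    using weak_star_subsequence[of Ms] invariantD(1,2) assms by blast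
  then have "M \<in> MX" using weak_limit_invariant[of "Ms \<circ> r" M] assms by simp
  then show thesis using r that by blast
qed

text \<open>A weak-star limit of empirical measures along an orbit in \<open>K\<close>. The limit
  stays on \<open>K\<close> because the distance to \<open>K\<close> has integral \<open>0\<close>
  for every empirical measure.\<close>

theorem Krylov_Bogolyubov:
  assumes K: "closed K" "K \<noteq> {}" "K \<subseteq> X" "f ` K \<subseteq> K"
  obtains \<mu> where "\<mu> \<in> MX" "emeasure \<mu> K = 1"
proof -
  obtain x where x: "x \<in> K" using K by blast
  have orb: "(f ^^ k) x \<in> K" for k using funpow_in[OF K(4) x] .
  \<comment> \<open>Sampling from \<open>{..n}\<close> rather than \<open>{..<n}\<close> keeps the
    sample nonempty for \<open>n = 0\<close>, so the averages run over \<open>n + 1\<close>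
    points.\<close>
  define E where "E n = distr (measure_pmf (pmf_of_set {..n})) BX (\<lambda>k. (f ^^ k) x)" for n :: nat
  have meas: "(\<lambda>k. (f ^^ k) x) \<in> measure_pmf p \<rightarrow>\<^sub>M BX" for p
    using orb K(3) by (auto simp: measurable_def)
  have prob: "prob_space (E n)" for n
    unfolding E_def by (intro prob_space.prob_space_distr[OF _ meas] measure_pmf.prob_space_axioms)
  have setsE: "sets (E n) = sets BX" for n by (simp add: E_def)
  have int: "integral\<^sup>L (E n) g = (\<Sum>k\<le>n. g ((f ^^ k) x)) / real (Suc n)" if "continuous_on X g" for g :: "'a \<Rightarrow> real" and n
    unfolding E_def using borel_measurable_continuous_on_restrict[OF that]
    by (subst integral_distr[OF meas]) (auto simp: integral_pmf_of_set)
  obtain r \<mu> where r: "strict_mono r" and \<mu>: "prob_space \<mu>" "sets \<mu> = sets BX" "weak_star_conv X (E \<circ> r) \<mu>"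
    by (rule weak_star_subsequence[of E, OF prob setsE])
  have lim: "(\<lambda>n. (\<Sum>k\<le>r n. g ((f ^^ k) x)) / real (Suc (r n))) \<longlonglongrightarrow> integral\<^sup>L \<mu> g" if "continuous_on X g" for g :: "'a \<Rightarrow> real"
  proof -
    have "(\<lambda>n. integral\<^sup>L (E (r n)) g) \<longlonglongrightarrow> integral\<^sup>L \<mu> g"
      using \<mu>(3) that unfolding weak_star_conv_def by simp
    then show ?thesis unfolding int[OF that] .
  qed
  have "\<mu> \<in> MX"
  proof (rule invariantI_continuous[OF \<mu>(1,2)])
    fix g :: "'a \<Rightarrow> real" assume g: "continuous_on X g"
    obtain B where B: "\<And>x. x \<in> X \<Longrightarrow> norm (g x) \<le> B"
      using compact_imp_bounded[OF compact_continuous_image[OF g cpt]] by (auto simp: bounded_iff)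
    have "(\<lambda>n. (\<Sum>k\<le>r n. g (f ((f ^^ k) x))) / real (Suc (r n)) - (\<Sum>k\<le>r n. g ((f ^^ k) x)) / real (Suc (r n))) \<longlonglongrightarrow> 0"
    proof (rule Lim_null_comparison)
      \<comment> \<open>Composition with \<open>f\<close> shifts the orbit sum by one step;
        telescoping leaves two boundary terms, of order \<open>1 / (m + 1)\<close> after
        averaging.\<close>
      have diff: "(\<Sum>k\<le>m. g (f ((f ^^ k) x))) - (\<Sum>k\<le>m. g ((f ^^ k) x)) = g ((f ^^ Suc m) x) - g x" for m
        by (induction m) auto
      have "norm ((\<Sum>k\<le>m. g (f ((f ^^ k) x))) / real (Suc m) - (\<Sum>k\<le>m. g ((f ^^ k) x)) / real (Suc m))
          \<le> 2 * B / real (Suc m)" for m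
      proof -
        have "\<bar>g ((f ^^ Suc m) x)\<bar> \<le> B" "\<bar>g x\<bar> \<le> B"
          using B[OF subsetD[OF K(3) orb[of "Suc m"]]] B[OF subsetD[OF K(3) x]] by simp_all
        then have "\<bar>g ((f ^^ Suc m) x) - g x\<bar> \<le> 2 * B" by linarith
        then show ?thesis
          unfolding diff_divide_distrib[symmetric] diff by (simp add: divide_right_mono del: of_nat_Suc funpow.simps)
      qed
      then show "eventually (\<lambda>n. norm ((\<Sum>k\<le>r n. g (f ((f ^^ k) x))) / real (Suc (r n)) - (\<Sum>k\<le>r n. g ((f ^^ k) x)) / real (Suc (r n)))
          \<le> 2 * B / real (Suc (r n))) sequentially" by simp
      show "(\<lambda>n. 2 * B / real (Suc (r n))) \<longlonglongrightarrow> 0"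
        using LIMSEQ_subseq_LIMSEQ[OF LIMSEQ_Suc[OF lim_const_over_n[of "2 * B"]] r] by (simp add: o_def)
    qed
    moreover have "(\<lambda>n. (\<Sum>k\<le>r n. g (f ((f ^^ k) x))) / real (Suc (r n)) - (\<Sum>k\<le>r n. g ((f ^^ k) x)) / real (Suc (r n)))
       \<longlonglongrightarrow> (\<integral>x. g (f x) \<partial>\<mu>) - (\<integral>x. g x \<partial>\<mu>)"
      by (intro tendsto_diff lim g continuous_on_compose_f)
    ultimately have "(\<integral>x. g (f x) \<partial>\<mu>) - (\<integral>x. g x \<partial>\<mu>) = 0" using LIMSEQ_unique by blast
    then show "(\<integral>x. g (f x) \<partial>\<mu>) = (\<integral>x. g x \<partial>\<mu>)" by simp
  qed
  moreover have "(\<integral>x. infdist x K \<partial>\<mu>) = 0"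
  proof -
    have "continuous_on X (\<lambda>x. infdist x K)" by (intro continuous_intros)
    from lim[OF this] show ?thesis by (simp add: orb LIMSEQ_const_iff)
  qed
  ultimately show thesis
    using emeasure_eq_1_if_infdist_integral_0[OF \<mu>(1,2) K(1-3)] that by blast
qed

section \<open>Supports, unique ergodicity and ergodic maximisers\<close>

lemma compact_subset_sets_BX: "compact C \<Longrightarrow> C \<subseteq> X \<Longrightarrow> C \<in> sets BX"
  using borel_closed[OF compact_imp_closed] by (auto simp: sets_restrict_space intro!: image_eqI[of _ _ C])

lemma open_Int_sets_BX: "open U \<Longrightarrow> U \<inter> X \<in> sets BX"
  by (auto simp: sets_restrict_space)

lemma msupp_subset: "msupp X \<mu> \<subseteq> X"
  by (auto simp: msupp_def)

lemma closed_msupp: "closed (msupp X \<mu>)"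
proof -
  have "msupp X \<mu> = X \<inter> - \<Union>{U. open U \<and> emeasure \<mu> (U \<inter> X) = 0}"
    by (auto simp: msupp_def)
  then show ?thesis using compact_imp_closed[OF cpt] by (auto intro!: closed_Int closed_Compl open_Union)
qed

lemma msupp_in_sets: "msupp X \<mu> \<in> sets BX"
proof (rule compact_subset_sets_BX[OF _ msupp_subset])
  have "compact (X \<inter> msupp X \<mu>)" using cpt closed_msupp by (rule compact_Int_closed)
  then show "compact (msupp X \<mu>)" using msupp_subset by (simp add: Int_absorb1)
qed

text \<open>Every point of \<open>C\<close> has a null open neighbourhood, and finitely many of
  these cover \<open>C\<close>.\<close>

lemma emeasure_compact_disjoint_msupp:
  assumes \<mu>: "sets \<mu> = sets BX" and C: "compact C" "C \<subseteq> X" "C \<inter> msupp X \<mu> = {}"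
  shows "emeasure \<mu> C = 0"
proof -
  define \<U> where "\<U> = {U. open U \<and> emeasure \<mu> (U \<inter> X) = 0}"
  have "C \<subseteq> \<Union>\<U>"
  proof
    fix x assume "x \<in> C"
    then have "x \<in> X" "x \<notin> msupp X \<mu>" using C by auto
    then obtain U where "open U" "x \<in> U" "\<not> 0 < emeasure \<mu> (U \<inter> X)" by (auto simp: msupp_def)
    then show "x \<in> \<Union>\<U>" by (auto simp: \<U>_def)
  qed
  then obtain \<V> where \<V>: "\<V> \<subseteq> \<U>" "finite \<V>" "C \<subseteq> \<Union>\<V>"
    by (rule compactE[OF C(1)]) (auto simp: \<U>_def)
  have "(\<Union>U\<in>\<V>. U \<inter> X) \<in> null_sets \<mu>"
    by (rule null_sets_UN'[OF countable_finite[OF \<V>(2)]])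
      (use \<V>(1) in \<open>auto simp: null_sets_def \<U>_def \<mu> open_Int_sets_BX\<close>)
  moreover have "C \<subseteq> (\<Union>U\<in>\<V>. U \<inter> X)" using \<V> C by auto
  ultimately have "C \<in> null_sets \<mu>"
    using null_sets_subset compact_subset_sets_BX[OF C(1,2)] \<mu> by blast
  then show ?thesis by (rule null_setsD1)
qed

text \<open>The complement of the support in \<open>X\<close> is the union of the compact sets of
  points at distance at least \<open>1 / (n + 1)\<close> from it, each of them null.\<close>

lemma emeasure_msupp:
  assumes \<mu>: "prob_space \<mu>" "sets \<mu> = sets BX"
  shows "msupp X \<mu> \<noteq> {}" "emeasure \<mu> (msupp X \<mu>) = 1"
proof -
  interpret prob_space \<mu> by fact
  have sp: "space \<mu> = X" using sets_eq_imp_space_eq[OF \<mu>(2)] by simp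
  define K where "K = msupp X \<mu>"
  show ne: "msupp X \<mu> \<noteq> {}"
  proof
    assume "msupp X \<mu> = {}"
    then have "emeasure \<mu> X = 0" using emeasure_compact_disjoint_msupp[OF \<mu>(2) cpt] by simp
    then show False using emeasure_space_1 sp by simp
  qed
  have K: "closed K" "K \<noteq> {}" "K \<subseteq> X" using closed_msupp ne msupp_subset by (auto simp: K_def)
  define C where "C n = X \<inter> {x. 1 / real (Suc n) \<le> infdist x K}" for n :: nat
  have cC: "compact (C n)" for n
    unfolding C_def by (intro compact_Int_closed cpt closed_Collect_le continuous_intros)
  have "C n \<inter> K = {}" for n by (auto simp: C_def)
  then have "C n \<in> null_sets \<mu>" for n
    using emeasure_compact_disjoint_msupp[OF \<mu>(2) cC, of n] compact_subset_sets_BX[OF cC, of n]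
    by (auto simp: C_def K_def \<mu>)
  then have AE_C: "AE x in \<mu>. \<forall>n. x \<notin> C n" unfolding AE_all_countable by (intro allI AE_not_in)
  have C_K: "x \<in> K" if "x \<in> X" "\<forall>n. x \<notin> C n" for x
  proof (rule ccontr)
    assume "x \<notin> K"
    then have "0 < infdist x K" using infdist_pos_not_in_closed K by blast
    then obtain n where "1 / real (Suc n) < infdist x K" using nat_approx_posE by blast
    then show False using that(1) spec[OF that(2), of n] by (simp add: C_def del: of_nat_Suc)
  qed
  have "AE x in \<mu>. x \<in> K"
    using AE_C AE_space by eventually_elim (use C_K sp in simp)
  moreover have "K \<in> sets \<mu>" by (simp add: \<mu>(2) K_def msupp_in_sets)
  ultimately show "emeasure \<mu> (msupp X \<mu>) = 1" using emeasure_eq_1_AE unfolding K_def by blast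
qed

lemma msupp_forward_invariant:
  assumes \<mu>: "\<mu> \<in> MX"
  shows "f ` msupp X \<mu> \<subseteq> msupp X \<mu>"
proof (rule image_subsetI)
  fix x assume x: "x \<in> msupp X \<mu>"
  then have xX: "x \<in> X" by (simp add: msupp_def)
  note I = invariantD[OF \<mu>]
  show "f x \<in> msupp X \<mu>"
    unfolding msupp_def
  proof (intro CollectI conjI allI impI)
    show "f x \<in> X" using xX fX by blast
    fix U assume U: "open U" "f x \<in> U"
    obtain V where V: "open V" "V \<inter> X = f -` U \<inter> X"
      using fcont U(1) unfolding continuous_on_open_invariant by blast
    have "x \<in> V" using V U xX by blast
    then have "0 < emeasure \<mu> (V \<inter> X)" using x V by (auto simp: msupp_def)
    also have "V \<inter> X = f -` (U \<inter> X) \<inter> X" using V fX by auto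
    also have "emeasure \<mu> (f -` (U \<inter> X) \<inter> X) = emeasure \<mu> (U \<inter> X)"
      by (rule I(5)) (use open_Int_sets_BX[OF U(1)] I(2) in simp)
    finally show "0 < emeasure \<mu> (U \<inter> X)" .
  qed
qed

text \<open>An invariant measure whose integral of \<open>u\<close> attains the maximum
  \<open>d\<close> satisfies \<open>u = d\<close> almost everywhere, so it lives on the support of
  \<open>\<mu>\<close>, and unique ergodicity identifies it with \<open>\<mu>\<close>.\<close>

lemma uniquely_ergodic_peak:
  fixes u :: "'a \<Rightarrow> real"
  assumes \<mu>: "uniquely_ergodic X f \<mu>" and u: "continuous_on X u"
    and le: "\<And>x. x \<in> X \<Longrightarrow> u x \<le> d" and eq: "\<And>x. x \<in> X \<Longrightarrow> u x = d \<longleftrightarrow> x \<in> msupp X \<mu>"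
  shows "integral\<^sup>L \<mu> u = d" and "\<nu> \<in> MX \<Longrightarrow> \<nu> \<noteq> \<mu> \<Longrightarrow> integral\<^sup>L \<nu> u < d"
proof -
  have \<mu>M: "\<mu> \<in> MX" using \<mu> by (simp add: uniquely_ergodic_def)
  have key: "integral\<^sup>L \<nu> u \<le> d \<and> (integral\<^sup>L \<nu> u = d \<longleftrightarrow> emeasure \<nu> (msupp X \<mu>) = 1)" if \<nu>: "\<nu> \<in> MX" for \<nu>
  proof -
    interpret prob_space \<nu> using invariantD[OF \<nu>] by blast
    have sp: "space \<nu> = X" using invariantD[OF \<nu>] by blast
    have intu: "integrable \<nu> u" using invariantD[OF \<nu>] u by (intro integrable_continuous_on)
    have int: "integrable \<nu> (\<lambda>x. d - u x)" using intu by simp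
    have e: "(\<integral>x. d - u x \<partial>\<nu>) = d - integral\<^sup>L \<nu> u"
      using intu by (simp add: prob_space)
    have nn: "AE x in \<nu>. 0 \<le> d - u x" by (rule AE_I2) (simp add: sp le)
    have "integral\<^sup>L \<nu> u = d \<longleftrightarrow> (AE x in \<nu>. d - u x = 0)"
      using integral_nonneg_eq_0_iff_AE[OF int nn] e by auto
    also have "\<dots> \<longleftrightarrow> (AE x in \<nu>. x \<in> msupp X \<mu>)"
      by (rule AE_cong) (use eq in \<open>auto simp: sp\<close>)
    also have "\<dots> \<longleftrightarrow> emeasure \<nu> (msupp X \<mu>) = 1"
      using emeasure_eq_1_AE[of "msupp X \<mu>"] AE_in_set_eq_1[of "msupp X \<mu>"] msupp_in_sets invariantD(2)[OF \<nu>]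
      by (auto simp: emeasure_eq_measure)
    finally show ?thesis using integral_nonneg_AE[OF nn] e by simp
  qed
  show "integral\<^sup>L \<mu> u = d" using key[OF \<mu>M] emeasure_msupp(2) invariantD[OF \<mu>M] by blast
  show "integral\<^sup>L \<nu> u < d" if "\<nu> \<in> MX" "\<nu> \<noteq> \<mu>"
    using key[OF that(1)] \<mu> that unfolding uniquely_ergodic_def by fastforce
qed

text \<open>A nonempty intersection would be closed and forward invariant, and an invariant measure
  on it would have to be \<open>\<mu>\<close> and \<open>\<nu>\<close> at once.\<close>

lemma uniquely_ergodic_msupp_disjoint:
  assumes \<mu>: "uniquely_ergodic X f \<mu>" and \<nu>: "uniquely_ergodic X f \<nu>" and ne: "\<mu> \<noteq> \<nu>"
  shows "msupp X \<mu> \<inter> msupp X \<nu> = {}"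
proof (rule ccontr)
  assume ne0: "\<not> ?thesis"
  have M: "\<mu> \<in> MX" "\<nu> \<in> MX" using \<mu> \<nu> by (simp_all add: uniquely_ergodic_def)
  obtain \<rho> where \<rho>: "\<rho> \<in> MX" "emeasure \<rho> (msupp X \<mu> \<inter> msupp X \<nu>) = 1"
  proof (rule Krylov_Bogolyubov)
    show "closed (msupp X \<mu> \<inter> msupp X \<nu>)" by (intro closed_Int closed_msupp)
    show "f ` (msupp X \<mu> \<inter> msupp X \<nu>) \<subseteq> msupp X \<mu> \<inter> msupp X \<nu>"
      using msupp_forward_invariant[OF M(1)] msupp_forward_invariant[OF M(2)] by blast
  qed (use ne0 msupp_subset in auto)
  interpret prob_space \<rho> using invariantD[OF \<rho>(1)] by blast
  have meas: "msupp X \<kappa> \<in> sets \<rho>" for \<kappa>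
    by (simp add: invariantD(2)[OF \<rho>(1)] msupp_in_sets)
  have "emeasure \<rho> (msupp X \<mu>) = 1" "emeasure \<rho> (msupp X \<nu>) = 1"
    using \<rho>(2) emeasure_mono[OF Int_lower1 meas, of \<mu> "msupp X \<nu>"] emeasure_mono[OF Int_lower2 meas, of "msupp X \<mu>" \<nu>]
      emeasure_le_1 by (auto intro: antisym)
  then show False using \<mu> \<nu> \<rho>(1) ne unfolding uniquely_ergodic_def by metis
qed

text \<open>Realised by choosing one of the two measures with a fair coin. The weights
  \<open>1 / 2\<close> and \<open>1 - 1 / 2\<close> match the combination lemmas at
  \<open>a = 1 / 2\<close>.\<close>

lemma midpoint_invariant:
  assumes \<mu>: "\<mu> \<in> MX" and \<nu>: "\<nu> \<in> MX"
  obtains \<rho> where "\<rho> \<in> MX" "\<And>A. A \<in> sets BX \<Longrightarrow> measure \<rho> A = 1 / 2 * measure \<mu> A + (1 - 1 / 2) * measure \<nu> A"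
proof -
  define p where "p = bernoulli_pmf (1 / 2)"
  define k where "k b = (if b then \<mu> else \<nu>)" for b
  define \<rho> where "\<rho> = measure_pmf p \<bind> k"
  note I = invariantD[OF \<mu>] invariantD[OF \<nu>]
  have k: "k \<in> measure_pmf p \<rightarrow>\<^sub>M subprob_algebra BX"
    using I by (auto simp: measurable_def space_subprob_algebra k_def prob_space_imp_subprob_space)
  have s: "sets \<rho> = sets BX"
    unfolding \<rho>_def by (rule sets_bind) (use I in \<open>auto simp: k_def\<close>)
  have m: "measure \<rho> A = 1 / 2 * measure \<mu> A + (1 - 1 / 2) * measure \<nu> A" if "A \<in> sets BX" for A
    using subprob_space.measure_bind[OF prob_space_imp_subprob_space[OF measure_pmf.prob_space_axioms] k that]
    by (simp add: \<rho>_def p_def k_def)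
  have pr: "prob_space \<rho>"
    unfolding \<rho>_def by (rule measure_pmf.prob_space_bind[OF _ k]) (auto simp: k_def I)
  then interpret prob_space \<rho> .
  have "\<rho> \<in> MX"
    unfolding invariant_measures_def
  proof (intro CollectI conjI ballI)
    fix A assume "A \<in> sets \<rho>"
    then have "A \<in> sets BX" "f -` A \<inter> X \<in> sets BX" using I s by auto
    then show "emeasure \<rho> (f -` A \<inter> X) = emeasure \<rho> A"
      using I by (simp add: emeasure_eq_measure m)
  qed (rule pr s)+
  then show thesis using that m by blast
qed

lemma integral_uniform_measure:
  fixes g :: "'b \<Rightarrow> real"
  assumes "prob_space M" "A \<in> sets M" "measure M A \<noteq> 0" "g \<in> borel_measurable M"
  shows "integral\<^sup>L (uniform_measure M A) g = (\<integral>x. indicator A x * g x \<partial>M) / measure M A"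
proof -
  interpret prob_space M by fact
  have pos: "0 < measure M A" using assms(3) measure_nonneg[of M A] by linarith
  have "uniform_measure M A = density M (\<lambda>x. ennreal (indicator A x / measure M A))"
    unfolding uniform_measure_def
    by (rule arg_cong[where f = "density M"])
      (use pos in \<open>auto simp: fun_eq_iff emeasure_eq_measure indicator_def divide_ennreal ennreal_1[symmetric] simp del: ennreal_1\<close>)
  then have "integral\<^sup>L (uniform_measure M A) g = (\<integral>x. (indicator A x / measure M A) * g x \<partial>M)"
    using integral_density[OF assms(4), of "\<lambda>x. indicator A x / measure M A"] assms(2) pos by simp
  then show ?thesis by simp
qed

text \<open>Strict invariance gives \<open>A \<inter> (f -\<close> B \<inter> X) = f
  -\<open>(A \<inter> B) \<inter> X\<close>, so conditioning on \<open>A\<close> commutes with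
  taking preimages.\<close>

lemma uniform_measure_invariant:
  assumes \<mu>: "\<mu> \<in> MX" and A: "A \<in> sets \<mu>" "f -` A \<inter> X = A" "measure \<mu> A \<noteq> 0"
  shows "uniform_measure \<mu> A \<in> MX"
proof -
  note I = invariantD[OF \<mu>]
  interpret prob_space \<mu> by (rule I)
  have ne: "emeasure \<mu> A \<noteq> 0" using A by (simp add: emeasure_eq_measure)
  show ?thesis
    unfolding invariant_measures_def
  proof (intro CollectI conjI ballI)
    show "prob_space (uniform_measure \<mu> A)"
      using ne by (intro prob_space_uniform_measure) (auto simp: emeasure_eq_measure)
    fix B assume "B \<in> sets (uniform_measure \<mu> A)"
    then have B: "B \<in> sets \<mu>" by simp
    have "A \<inter> (f -` B \<inter> X) = f -` (A \<inter> B) \<inter> X" using A(2) by auto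
    then have "emeasure \<mu> (A \<inter> (f -` B \<inter> X)) = emeasure \<mu> (A \<inter> B)"
      using I(5)[of "A \<inter> B"] A B by simp
    then show "emeasure (uniform_measure \<mu> A) (f -` B \<inter> X) = emeasure (uniform_measure \<mu> A) B"
      using A B I(4)[OF B] by simp
  qed (simp add: I)
qed

text \<open>\<open>real_of_ereal\<close> sends infinity to \<open>0\<close>, so this is the entropy
  only once finiteness is established; afterwards all comparisons take place in the reals.\<close>

definition real_entropy :: "'a measure \<Rightarrow> real" where
  "real_entropy \<mu> = real_of_ereal (metric_entropy X f \<mu>)"

lemma metric_entropy_eq_ereal:
  assumes "\<mu> \<in> MX" "metric_entropy X f \<mu> < \<infinity>"
  shows "metric_entropy X f \<mu> = ereal (real_entropy \<mu>)"
  using metric_entropy_nonneg[OF assms(1)] assms(2)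
  unfolding real_entropy_def by (intro ereal_real'[symmetric]) auto

text \<open>An invariant set of intermediate measure splits \<open>\<mu>\<close> into two invariant
  conditional measures. Entropy is convex and the integral affine, so the value at
  \<open>\<mu>\<close> is at most the weighted average of the two values; but \<open>\<nu>\<close>
  has full mass on \<open>A\<close>, differs from \<open>\<mu>\<close>, and so has a strictly
  smaller value. Allowing \<open>c = 0\<close> includes the ends of the path.\<close>

lemma unique_maximizer_ergodic:
  assumes fin: "\<And>\<nu>. \<nu> \<in> MX \<Longrightarrow> metric_entropy X f \<nu> < \<infinity>"
    and \<mu>: "\<mu> \<in> MX" and g: "continuous_on X (g :: 'a \<Rightarrow> real)" and c: "0 \<le> c"
    and max: "\<And>\<nu>. \<nu> \<in> MX \<Longrightarrow> \<nu> \<noteq> \<mu> \<Longrightarrow> c * real_entropy \<nu> + integral\<^sup>L \<nu> g < c * real_entropy \<mu> + integral\<^sup>L \<mu> g"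
  shows "\<mu> \<in> ergodic_measures X f"
proof (rule ccontr)
  note I = invariantD[OF \<mu>]
  interpret prob_space \<mu> by (rule I)
  assume "\<mu> \<notin> ergodic_measures X f"
  then obtain A where A: "A \<in> sets \<mu>" "f -` A \<inter> X = A" "prob A \<noteq> 0" "prob A \<noteq> 1"
    using \<mu> by (auto simp: ergodic_measures_def emeasure_eq_measure)
  define a where "a = prob A"
  have a: "0 < a" "a < 1" using A(3,4) measure_nonneg[of \<mu> A] prob_le_1[of A] unfolding a_def by linarith+
  have A': "X - A \<in> sets \<mu>" "prob (X - A) = 1 - a"
    using prob_compl[OF A(1)] sets.compl_sets[OF A(1)] by (auto simp: I(3) a_def)
  have fA': "f -` (X - A) \<inter> X = X - A"
    using fX A(2) by blast
  define \<nu> where "\<nu> = uniform_measure \<mu> A"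
  define \<rho> where "\<rho> = uniform_measure \<mu> (X - A)"
  have \<nu>: "\<nu> \<in> MX" unfolding \<nu>_def by (rule uniform_measure_invariant) (use \<mu> A in auto)
  have \<rho>: "\<rho> \<in> MX" unfolding \<rho>_def by (rule uniform_measure_invariant) (use \<mu> A' fA' a in auto)
  have ne: "emeasure \<mu> A \<noteq> 0" "emeasure \<mu> (X - A) \<noteq> 0"
    using a A' unfolding a_def by (auto simp: emeasure_eq_measure)
  have comb: "measure \<mu> B = a * measure \<nu> B + (1 - a) * measure \<rho> B" if "B \<in> sets BX" for B
  proof -
    have B: "B \<in> sets \<mu>" using that I by simp
    have "measure \<nu> B = prob (A \<inter> B) / a" "measure \<rho> B = prob ((X - A) \<inter> B) / (1 - a)"
      unfolding \<nu>_def \<rho>_def using ne B by (auto simp: a_def A'(2)[unfolded a_def])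
    moreover have "prob B = prob (A \<inter> B) + prob ((X - A) \<inter> B)"
    proof -
      have "B = (A \<inter> B) \<union> ((X - A) \<inter> B)" using sets.sets_into_space[OF B] I(3) by auto
      then show ?thesis using finite_measure_Union[of "A \<inter> B" "(X - A) \<inter> B"] A A' B by auto
    qed
    ultimately show ?thesis using a by simp
  qed
  have intg: "integral\<^sup>L \<mu> g = a * integral\<^sup>L \<nu> g + (1 - a) * integral\<^sup>L \<rho> g"
  proof -
    have gm: "g \<in> borel_measurable \<mu>" using g I by (intro measurable_continuous_on)
    have gi: "integrable \<mu> g" using g I by (intro integrable_continuous_on)
    have "a * integral\<^sup>L \<nu> g = (\<integral>x. indicator A x * g x \<partial>\<mu>)"
      unfolding \<nu>_def using integral_uniform_measure[OF I(1) A(1) A(3) gm] a by (simp add: a_def)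
    moreover have "(1 - a) * integral\<^sup>L \<rho> g = (\<integral>x. indicator (X - A) x * g x \<partial>\<mu>)"
      unfolding \<rho>_def using integral_uniform_measure[OF I(1) A'(1) _ gm] a by (simp add: A'(2))
    moreover have "(\<integral>x. indicator A x * g x \<partial>\<mu>) + (\<integral>x. indicator (X - A) x * g x \<partial>\<mu>) = integral\<^sup>L \<mu> g"
    proof -
      have "(\<integral>x. indicator A x * g x \<partial>\<mu>) + (\<integral>x. indicator (X - A) x * g x \<partial>\<mu>)
          = (\<integral>x. indicator A x * g x + indicator (X - A) x * g x \<partial>\<mu>)"
        using integrable_real_mult_indicator[OF A(1) gi] integrable_real_mult_indicator[OF A'(1) gi]
        by (intro Bochner_Integration.integral_add[symmetric]) (simp_all add: mult.commute)
      also have "\<dots> = integral\<^sup>L \<mu> g"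
        by (rule Bochner_Integration.integral_cong) (auto simp: I(3) indicator_def)
      finally show ?thesis .
    qed
    ultimately show ?thesis by simp
  qed
  have ent_le: "real_entropy \<mu> \<le> a * real_entropy \<nu> + (1 - a) * real_entropy \<rho>"
    using metric_entropy_convex_combination_le[OF \<mu> \<nu> \<rho> a comb]
    by (simp add: metric_entropy_eq_ereal[OF _ fin] \<mu> \<nu> \<rho>)
  have "measure \<nu> A = 1" unfolding \<nu>_def using ne A by simp
  then have "\<nu> \<noteq> \<mu>" using A by auto
  then have lt: "c * real_entropy \<nu> + integral\<^sup>L \<nu> g < c * real_entropy \<mu> + integral\<^sup>L \<mu> g" using max \<nu> by blast
  have le: "c * real_entropy \<rho> + integral\<^sup>L \<rho> g \<le> c * real_entropy \<mu> + integral\<^sup>L \<mu> g" using max \<rho> by fastforce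
  have "c * real_entropy \<mu> + integral\<^sup>L \<mu> g \<le> a * (c * real_entropy \<nu> + integral\<^sup>L \<nu> g) + (1 - a) * (c * real_entropy \<rho> + integral\<^sup>L \<rho> g)"
    using mult_left_mono[OF ent_le c] intg by (simp add: algebra_simps)
  also have "\<dots> < a * (c * real_entropy \<mu> + integral\<^sup>L \<mu> g) + (1 - a) * (c * real_entropy \<mu> + integral\<^sup>L \<mu> g)"
    by (intro add_less_le_mono mult_strict_left_mono mult_left_mono lt le) (use a in auto)
  finally show False by (simp add: algebra_simps)
qed

end

section \<open>The path of maximisers\<close>

text \<open>If \<open>F (x n)\<close> failed to converge, a subsequence would stay at distance at
  least \<open>e\<close> from \<open>F t\<close>; applying the hypothesis to that subsequence is
  contradictory. It fits compactness arguments, which only yield convergent subsequences.\<close>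

lemma continuous_on_subsequentialI:
  fixes F :: "real \<Rightarrow> real"
  assumes sub: "\<And>x t. (\<And>n. x n \<in> S) \<Longrightarrow> t \<in> S \<Longrightarrow> x \<longlonglongrightarrow> t \<Longrightarrow>
      \<exists>r :: nat \<Rightarrow> nat. strict_mono r \<and> (\<lambda>n. F (x (r n))) \<longlonglongrightarrow> F t"
  shows "continuous_on S F"
  unfolding continuous_on_sequentially
proof (intro ballI allI impI, elim conjE)
  fix x t assume t: "t \<in> S" and x: "\<forall>n. x n \<in> S" "x \<longlonglongrightarrow> t"
  show "(F \<circ> x) \<longlonglongrightarrow> F t"
  proof (rule ccontr)
    assume "\<not> ?thesis"
    then obtain e where e: "0 < e" "\<not> eventually (\<lambda>n. dist (F (x n)) (F t) < e) sequentially"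
      unfolding tendsto_iff by (auto simp: o_def)
    define I where "I = {n. e \<le> dist (F (x n)) (F t)}"
    have "infinite I"
      using e(2) unfolding I_def not_eventually frequently_cofinite[symmetric] cofinite_eq_sequentially not_less by simp
    define q where "q = enumerate I"
    have q: "strict_mono q" "\<And>n. q n \<in> I"
      using \<open>infinite I\<close> by (auto simp: q_def strict_mono_enumerate enumerate_in_set)
    have "(\<lambda>n. x (q n)) \<longlonglongrightarrow> t" using LIMSEQ_subseq_LIMSEQ[OF x(2) q(1)] by (simp add: o_def)
    then obtain r where r: "(\<lambda>n. F (x (q (r n)))) \<longlonglongrightarrow> F t" using sub[of "\<lambda>n. x (q n)" t] x t by blast
    then have "eventually (\<lambda>n. dist (F (x (q (r n)))) (F t) < e) sequentially"
      using e(1) unfolding tendsto_iff by blast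
    then obtain n where "dist (F (x (q (r n)))) (F t) < e" by (auto simp: eventually_sequentially)
    then show False using q(2)[of "r n"] by (simp add: I_def)
  qed
qed

text \<open>Only the variational description is kept: a strict maximiser for every parameter, ends
  included. Zero entropy at the ends is a separate assumption because the entropy term of the
  functional vanishes there.\<close>

locale tilted_maximizers = compact_system X f for X :: "'a::metric_space set" and f +
  fixes g :: "'a \<Rightarrow> real" and N :: "real \<Rightarrow> 'a measure"
  assumes g: "continuous_on X g"
    and usc: "\<And>\<mu>s \<mu>. (\<forall>n. \<mu>s n \<in> MX) \<Longrightarrow> \<mu> \<in> MX \<Longrightarrow> weak_star_conv X \<mu>s \<mu> \<Longrightarrow>
      limsup (\<lambda>n. metric_entropy X f (\<mu>s n)) \<le> metric_entropy X f \<mu>"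
    and fin: "\<And>\<mu>. \<mu> \<in> MX \<Longrightarrow> metric_entropy X f \<mu> < \<infinity>"
    and N_in: "\<And>t. t \<in> {-1..1} \<Longrightarrow> N t \<in> MX"
    and N_max: "\<And>t \<mu>. t \<in> {-1..1} \<Longrightarrow> \<mu> \<in> MX \<Longrightarrow> \<mu> \<noteq> N t \<Longrightarrow>
      (1 - \<bar>t\<bar>) * real_entropy \<mu> - t * integral\<^sup>L \<mu> g < (1 - \<bar>t\<bar>) * real_entropy (N t) - t * integral\<^sup>L (N t) g"
    and N_ends: "real_entropy (N (-1)) = 0" "real_entropy (N 1) = 0"
begin

lemma N_max_le:
  assumes "t \<in> {-1..1}" "\<mu> \<in> MX"
  shows "(1 - \<bar>t\<bar>) * real_entropy \<mu> - t * integral\<^sup>L \<mu> g \<le> (1 - \<bar>t\<bar>) * real_entropy (N t) - t * integral\<^sup>L (N t) g"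
  using N_max[OF assms] by (cases "\<mu> = N t") auto

lemma real_entropy_nonneg: "\<mu> \<in> MX \<Longrightarrow> 0 \<le> real_entropy \<mu>"
  unfolding real_entropy_def using metric_entropy_nonneg by (intro real_of_ereal_pos)

lemma ergodic: "t \<in> {-1..1} \<Longrightarrow> N t \<in> ergodic_measures X f"
proof (rule unique_maximizer_ergodic[where c = "1 - \<bar>t\<bar>" and g = "\<lambda>x. - t * g x"])
  assume t: "t \<in> {-1..1}"
  show "continuous_on X (\<lambda>x. - t * g x)" by (intro continuous_intros g)
  show "0 \<le> 1 - \<bar>t\<bar>" using t by auto
  fix \<nu> assume "\<nu> \<in> MX" "\<nu> \<noteq> N t"
  then show "(1 - \<bar>t\<bar>) * real_entropy \<nu> + (\<integral>x. - t * g x \<partial>\<nu>) < (1 - \<bar>t\<bar>) * real_entropy (N t) + (\<integral>x. - t * g x \<partial>N t)"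
    using N_max[OF t] by simp
qed (use fin N_in in auto)

lemma eventually_entropy_less:
  assumes "\<And>n. \<mu>s n \<in> MX" "\<mu> \<in> MX" "weak_star_conv X \<mu>s \<mu>" "0 < e"
  shows "eventually (\<lambda>n. real_entropy (\<mu>s n) < real_entropy \<mu> + e) sequentially"
proof -
  have "limsup (\<lambda>n. metric_entropy X f (\<mu>s n)) < ereal (real_entropy \<mu> + e)"
  proof (rule order_le_less_trans)
    show "limsup (\<lambda>n. metric_entropy X f (\<mu>s n)) \<le> metric_entropy X f \<mu>" using usc assms by blast
    show "metric_entropy X f \<mu> < ereal (real_entropy \<mu> + e)"
      using assms(4) by (simp add: metric_entropy_eq_ereal[OF _ fin] assms(2))
  qed
  from Limsup_lessD[OF this] show ?thesis
    by eventually_elim (simp add: metric_entropy_eq_ereal[OF _ fin] assms(1))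
qed

text \<open>Upper semicontinuity lets the maximality inequality pass to a limit measure, and
  strictness of \<open>N_max\<close> then identifies that measure with \<open>N t\<close>.\<close>

lemma subsequence_limit:
  fixes \<tau> :: "nat \<Rightarrow> real"
  assumes \<tau>: "\<And>n. \<tau> n \<in> {-1..1}" and t: "t \<in> {-1..1}" and lim: "\<tau> \<longlonglongrightarrow> t"
  obtains r where "strict_mono r" "weak_star_conv X (\<lambda>n. N (\<tau> (r n))) (N t)"
    "(\<lambda>n. real_entropy (N (\<tau> (r n)))) \<longlonglongrightarrow> real_entropy (N t)"
proof -
  obtain r M where r: "strict_mono r" and M: "M \<in> MX" and conv: "weak_star_conv X ((\<lambda>n. N (\<tau> n)) \<circ> r) M"
    using invariant_measures_weak_star_subsequence[of "\<lambda>n. N (\<tau> n)"] N_in \<tau> by blast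
  define \<sigma> where "\<sigma> = (\<lambda>n. \<tau> (r n))"
  have \<sigma>: "\<sigma> n \<in> {-1..1}" "N (\<sigma> n) \<in> MX" for n using \<tau> N_in by (auto simp: \<sigma>_def)
  have lim\<sigma>: "\<sigma> \<longlonglongrightarrow> t"
    using LIMSEQ_subseq_LIMSEQ[OF lim r] by (simp add: \<sigma>_def o_def)
  have conv: "weak_star_conv X (\<lambda>n. N (\<sigma> n)) M" using conv by (simp add: \<sigma>_def o_def)
  then have limg: "(\<lambda>n. integral\<^sup>L (N (\<sigma> n)) g) \<longlonglongrightarrow> integral\<^sup>L M g"
    using g by (simp add: weak_star_conv_def)
  have "M = N t"
  proof (rule ccontr)
    assume "M \<noteq> N t"
    \<comment> \<open>Upper semicontinuity is available as an eventual bound with slack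
      \<open>e\<close>; the slack is removed afterwards.\<close>
    have *: "(1 - \<bar>t\<bar>) * real_entropy (N t) - t * integral\<^sup>L (N t) g
      \<le> (1 - \<bar>t\<bar>) * (real_entropy M + e) - t * integral\<^sup>L M g" if e: "0 < e" for e
    proof (rule tendsto_le[OF sequentially_bot])
      show "(\<lambda>n. (1 - \<bar>\<sigma> n\<bar>) * (real_entropy M + e) - \<sigma> n * integral\<^sup>L (N (\<sigma> n)) g)
          \<longlonglongrightarrow> (1 - \<bar>t\<bar>) * (real_entropy M + e) - t * integral\<^sup>L M g"
        by (intro tendsto_intros lim\<sigma> limg)
      show "(\<lambda>n. (1 - \<bar>\<sigma> n\<bar>) * real_entropy (N t) - \<sigma> n * integral\<^sup>L (N t) g)
          \<longlonglongrightarrow> (1 - \<bar>t\<bar>) * real_entropy (N t) - t * integral\<^sup>L (N t) g"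
        by (intro tendsto_intros lim\<sigma>)
      show "eventually (\<lambda>n. (1 - \<bar>\<sigma> n\<bar>) * real_entropy (N t) - \<sigma> n * integral\<^sup>L (N t) g
          \<le> (1 - \<bar>\<sigma> n\<bar>) * (real_entropy M + e) - \<sigma> n * integral\<^sup>L (N (\<sigma> n)) g) sequentially"
        using eventually_entropy_less[OF \<sigma>(2) M conv e]
      proof eventually_elim
        case (elim n)
        have "0 \<le> 1 - \<bar>\<sigma> n\<bar>" using \<sigma>(1)[of n] by auto
        then have "(1 - \<bar>\<sigma> n\<bar>) * real_entropy (N (\<sigma> n)) \<le> (1 - \<bar>\<sigma> n\<bar>) * (real_entropy M + e)"
          using elim by (intro mult_left_mono) auto
        then show ?case using N_max_le[OF \<sigma>(1) N_in[OF t], of n] by linarith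
      qed
    qed
    have "(1 - \<bar>t\<bar>) * real_entropy (N t) - t * integral\<^sup>L (N t) g
      \<le> (1 - \<bar>t\<bar>) * real_entropy M - t * integral\<^sup>L M g + e" if "0 < e" for e
    proof -
      have "(1 - \<bar>t\<bar>) * e \<le> e" using that t by (intro mult_left_le_one_le) auto
      then show ?thesis
        using *[OF that] by (simp add: algebra_simps)
    qed
    then have "(1 - \<bar>t\<bar>) * real_entropy (N t) - t * integral\<^sup>L (N t) g
      \<le> (1 - \<bar>t\<bar>) * real_entropy M - t * integral\<^sup>L M g" by (rule field_le_epsilon)
    then show False using N_max[OF t M \<open>M \<noteq> N t\<close>] by simp
  qed
  note conv = conv[unfolded this] and limg = limg[unfolded this]
  have "(\<lambda>n. real_entropy (N (\<sigma> n))) \<longlonglongrightarrow> real_entropy (N t)"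
  proof (rule order_tendstoI)
    fix a assume "real_entropy (N t) < a"
    then show "eventually (\<lambda>n. real_entropy (N (\<sigma> n)) < a) sequentially"
      using eventually_entropy_less[OF \<sigma>(2) N_in[OF t] conv, of "a - real_entropy (N t)"] by simp
  next
    fix a assume a: "a < real_entropy (N t)"
    show "eventually (\<lambda>n. a < real_entropy (N (\<sigma> n))) sequentially"
    \<comment> \<open>At the ends maximality says nothing about entropy, but the limit value is
      \<open>0\<close> and entropy is nonnegative.\<close>
    proof (cases "\<bar>t\<bar> = 1")
      case True
      then have "real_entropy (N t) = 0" using N_ends by (auto simp: abs_if split: if_splits)
      then have "a < real_entropy (N (\<sigma> n))" for n
        using a real_entropy_nonneg[OF \<sigma>(2)[of n]] by linarith
      then show ?thesis by simp
    next
      case False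
      then have t1: "\<bar>t\<bar> < 1" using t by auto
      \<comment> \<open>This is the lower bound obtained by testing \<open>N (\<sigma> n)\<close>
        against \<open>N t\<close> and dividing by \<open>1 - \<bar>\<sigma> n\<bar>\<close>; the
        integrals of \<open>g\<close> have the same limit, so the correction vanishes.\<close>
      have "(\<lambda>n. real_entropy (N t) + \<sigma> n * (integral\<^sup>L (N (\<sigma> n)) g - integral\<^sup>L (N t) g) / (1 - \<bar>\<sigma> n\<bar>))
        \<longlonglongrightarrow> real_entropy (N t) + t * (integral\<^sup>L (N t) g - integral\<^sup>L (N t) g) / (1 - \<bar>t\<bar>)"
        using t1 by (intro tendsto_intros lim\<sigma> limg) auto
      then have "eventually (\<lambda>n. a < real_entropy (N t) + \<sigma> n * (integral\<^sup>L (N (\<sigma> n)) g - integral\<^sup>L (N t) g) / (1 - \<bar>\<sigma> n\<bar>)) sequentially"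
        using a by (intro order_tendstoD) auto
      moreover have "eventually (\<lambda>n. \<bar>\<sigma> n\<bar> < 1) sequentially"
        by (rule order_tendstoD(2)[OF tendsto_rabs[OF lim\<sigma>] t1])
      ultimately show ?thesis
      proof eventually_elim
        case (elim n)
        have "\<sigma> n * (integral\<^sup>L (N (\<sigma> n)) g - integral\<^sup>L (N t) g) \<le> (1 - \<bar>\<sigma> n\<bar>) * (real_entropy (N (\<sigma> n)) - real_entropy (N t))"
          using N_max_le[OF \<sigma>(1) N_in[OF t], of n] by (simp add: algebra_simps)
        then have "\<sigma> n * (integral\<^sup>L (N (\<sigma> n)) g - integral\<^sup>L (N t) g) / (1 - \<bar>\<sigma> n\<bar>) \<le> real_entropy (N (\<sigma> n)) - real_entropy (N t)"
          using elim(2) by (simp add: pos_divide_le_eq mult.commute)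
        then show ?case using elim(1) by linarith
      qed
    qed
  qed
  then show thesis using that[OF r] conv unfolding \<sigma>_def by blast
qed

lemma weak_star_continuous: "weak_star_continuous_on {-1..1} X N"
  unfolding weak_star_continuous_on_def
proof (intro allI impI)
  fix u :: "'a \<Rightarrow> real" assume u: "continuous_on X u"
  show "continuous_on {-1..1} (\<lambda>t. integral\<^sup>L (N t) u)"
  proof (rule continuous_on_subsequentialI)
    fix x :: "nat \<Rightarrow> real" and t assume "\<And>n. x n \<in> {-1..1}" "t \<in> {-1..1}" "x \<longlonglongrightarrow> t"
    then obtain r where "strict_mono r" "weak_star_conv X (\<lambda>n. N (x (r n))) (N t)"
      using subsequence_limit by blast
    then show "\<exists>r :: nat \<Rightarrow> nat. strict_mono r \<and> (\<lambda>n. integral\<^sup>L (N (x (r n))) u) \<longlonglongrightarrow> integral\<^sup>L (N t) u"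
      using u unfolding weak_star_conv_def by blast
  qed
qed

lemma metric_entropy_N: "t \<in> {-1..1} \<Longrightarrow> metric_entropy X f (N t) = ereal (real_entropy (N t))"
  using metric_entropy_eq_ereal N_in fin by blast

lemma entropy_continuous: "continuous_on {-1..1} (\<lambda>t. metric_entropy X f (N t))"
proof -
  have "continuous_on {-1..1} (\<lambda>t. real_entropy (N t))"
    by (rule continuous_on_subsequentialI) (metis subsequence_limit)
  then have "continuous_on {-1..1} (\<lambda>t. ereal (real_entropy (N t)))"
    by (rule continuous_on_ereal)
  then show ?thesis by (subst continuous_on_cong[OF refl metric_entropy_N]) auto
qed

text \<open>Each of the two measures is tested at the parameter of the other. Weighting the
  inequalities by \<open>- t\<close> and \<open>- s\<close> makes the terms in \<open>b\<close>
  equal, so \<open>g\<close> drops out and only \<open>(t - s) * a \<le> 0\<close> remains.\<close>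

lemma entropy_mono: "mono_on {-1..0} (\<lambda>t. metric_entropy X f (N t))"
proof (rule mono_onI)
  fix s t :: real assume s: "s \<in> {-1..0}" and t: "t \<in> {-1..0}" and le: "s \<le> t"
  then have m: "s \<in> {-1..1}" "t \<in> {-1..1}" by auto
  have "real_entropy (N s) \<le> real_entropy (N t)"
  proof (cases "s = t")
    case False
    define a where "a = real_entropy (N s) - real_entropy (N t)"
    define b where "b = integral\<^sup>L (N s) g - integral\<^sup>L (N t) g"
    have "0 \<le> (1 + s) * a - s * b" "(1 + t) * a - t * b \<le> 0"
      using N_max_le[OF m(1) N_in[OF m(2)]] N_max_le[OF m(2) N_in[OF m(1)]] s t
      by (simp_all add: a_def b_def algebra_simps)
    then have "0 \<le> (- t) * ((1 + s) * a - s * b)" "(- s) * ((1 + t) * a - t * b) \<le> 0"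
      using mult_nonneg_nonneg[of "- t"] mult_nonneg_nonpos[of "- s"] s t by (auto simp del: mult_minus_left)
    then have "(t - s) * a \<le> 0" by (simp add: algebra_simps)
    then show ?thesis using le False by (simp add: a_def mult_le_0_iff)
  qed simp
  then show "metric_entropy X f (N s) \<le> metric_entropy X f (N t)" unfolding metric_entropy_N[OF m(1)] metric_entropy_N[OF m(2)] by simp
qed

lemma entropy_antimono: "antimono_on {0..1} (\<lambda>t. metric_entropy X f (N t))"
proof (rule monotone_onI)
  fix s t :: real assume s: "s \<in> {0..1}" and t: "t \<in> {0..1}" and le: "s \<le> t"
  then have m: "s \<in> {-1..1}" "t \<in> {-1..1}" by auto
  have "real_entropy (N t) \<le> real_entropy (N s)"
  proof (cases "s = t")
    case False
    define a where "a = real_entropy (N s) - real_entropy (N t)"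
    define b where "b = integral\<^sup>L (N s) g - integral\<^sup>L (N t) g"
    have "0 \<le> (1 - s) * a - s * b" "(1 - t) * a - t * b \<le> 0"
      using N_max_le[OF m(1) N_in[OF m(2)]] N_max_le[OF m(2) N_in[OF m(1)]] s t
      by (simp_all add: a_def b_def algebra_simps)
    then have "0 \<le> t * ((1 - s) * a - s * b)" "s * ((1 - t) * a - t * b) \<le> 0"
      using mult_nonneg_nonneg[of t] mult_nonneg_nonpos[of s] s t by auto
    then have "0 \<le> (t - s) * a" by (simp add: algebra_simps)
    then show ?thesis using le False by (simp add: a_def zero_le_mult_iff)
  qed simp
  then show "metric_entropy X f (N t) \<le> metric_entropy X f (N s)" unfolding metric_entropy_N[OF m(1)] metric_entropy_N[OF m(2)] by simp
qed

lemma halves_meet_only_at_0: "N ` {-1..0} \<inter> N ` {0..1} = {N 0}"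
proof (intro equalityI subsetI)
  fix \<mu> assume "\<mu> \<in> N ` {-1..0} \<inter> N ` {0..1}"
  then obtain s t where s: "s \<in> {-1..0}" "\<mu> = N s" and t: "t \<in> {0..1}" "\<mu> = N t" by auto
  then have m: "s \<in> {-1..1}" "t \<in> {-1..1}" "0 \<in> {-1..1::real}" by auto
  have "\<mu> = N 0"
  proof (rule ccontr)
    assume ne: "\<mu> \<noteq> N 0"
    then have st: "s < 0" "0 < t" using s t by (metis atLeastAtMost_iff order_le_less)+
    define a where "a = real_entropy (N 0) - real_entropy \<mu>"
    define b where "b = integral\<^sup>L (N 0) g - integral\<^sup>L \<mu> g"
    have "0 < a" using N_max[OF m(3) _ ne] N_in[OF m(1)] s(2) by (simp add: a_def)
    have "(1 + s) * a - s * b < 0" "(1 - t) * a - t * b < 0"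
      using N_max[OF m(1) N_in[OF m(3)]] N_max[OF m(2) N_in[OF m(3)]] ne s t st
      by (simp_all add: a_def b_def algebra_simps)
    \<comment> \<open>The terms in \<open>b\<close> cancel. Strictness of both inequalities covers
      \<open>s = -1\<close>, \<open>t = 1\<close>, where the remaining coefficient of
      \<open>a\<close> is zero.\<close>
    then have "t * ((1 + s) * a - s * b) + (- s) * ((1 - t) * a - t * b) < 0"
      using st by (intro add_neg_neg mult_pos_neg) auto
    then have "(t * (1 + s) + (- s) * (1 - t)) * a < 0" by (simp add: algebra_simps)
    moreover have "0 \<le> t * (1 + s)" "0 \<le> (- s) * (1 - t)"
      using s t st by (intro mult_nonneg_nonneg; simp)+
    then have "0 \<le> (t * (1 + s) + (- s) * (1 - t)) * a"
      using \<open>0 < a\<close> by (intro mult_nonneg_nonneg[OF add_nonneg_nonneg]) auto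
    ultimately show False by simp
  qed
  then show "\<mu> \<in> {N 0}" by simp
qed (auto intro!: image_eqI[of _ _ 0])

end

section \<open>Separation of the supports and finiteness of entropy\<close>

context compact_system
begin

lemma separating_function:
  assumes K: "compact K" "K \<noteq> {}" and L: "compact L" "L \<noteq> {}" and disj: "K \<inter> L = {}"
  shows "\<exists>(g :: 'a \<Rightarrow> real) d. 2-lipschitz_on UNIV g \<and>
    (\<forall>x. g x \<le> d) \<and> (\<forall>x. g x = d \<longleftrightarrow> x \<in> K) \<and> (\<forall>x. - g x \<le> d) \<and> (\<forall>x. - g x = d \<longleftrightarrow> x \<in> L)"
proof -
  have pos: "\<exists>d>0. \<forall>x\<in>A. d \<le> infdist x B" if A: "compact A" "A \<noteq> {}" and B: "compact B" "B \<noteq> {}" and AB: "A \<inter> B = {}" for A B :: "'a set"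
  proof -
    have "continuous_on A (\<lambda>x. infdist x B)" by (intro continuous_intros)
    from continuous_attains_inf[OF A this] obtain x where x: "x \<in> A" "\<forall>y\<in>A. infdist x B \<le> infdist y B" by blast
    moreover have "x \<notin> B" using x AB by blast
    then have "0 < infdist x B" using infdist_pos_not_in_closed[OF compact_imp_closed[OF B(1)] B(2)] by blast
    ultimately show ?thesis by blast
  qed
  obtain d1 where d1: "d1 > 0" "\<And>x. x \<in> K \<Longrightarrow> d1 \<le> infdist x L" using pos[OF K L disj] by blast
  obtain d2 where d2: "d2 > 0" "\<And>x. x \<in> L \<Longrightarrow> d2 \<le> infdist x K" using pos[OF L K] disj by blast
  define d where "d = min d1 d2"
  have d: "d > 0" "\<And>x. x \<in> K \<Longrightarrow> d \<le> infdist x L" "\<And>x. x \<in> L \<Longrightarrow> d \<le> infdist x K"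
    using d1 d2 by (auto simp: d_def min_le_iff_disj)
  \<comment> \<open>Truncation at \<open>d\<close>, which bounds the distance between the sets from
    below, puts both terms between \<open>0\<close> and \<open>d\<close>. So \<open>g x = d\<close>
    forces \<open>infdist x K = 0\<close>, and on \<open>K\<close> the first term is indeed
    \<open>d\<close>. The Lipschitz constant 2 counts one for each distance.\<close>
  define g where "g x = min (infdist x L) d - min (infdist x K) d" for x
  have zero: "infdist x K = 0 \<longleftrightarrow> x \<in> K" "infdist x L = 0 \<longleftrightarrow> x \<in> L" for x
    using in_closed_iff_infdist_zero K L compact_imp_closed by blast+
  have nn: "0 \<le> infdist x K" "0 \<le> infdist x L" for x by (rule infdist_nonneg)+
  show ?thesis
  proof (intro exI[of _ g] exI[of _ d] conjI allI)
    show "2-lipschitz_on UNIV g"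
    proof (rule lipschitz_onI)
      fix x y
      have "\<bar>infdist x K - infdist y K\<bar> \<le> dist x y" "\<bar>infdist x L - infdist y L\<bar> \<le> dist x y"
        by (rule infdist_triangle_abs)+
      then show "dist (g x) (g y) \<le> 2 * dist x y" unfolding g_def dist_real_def by linarith
    qed simp
    fix x
    show "g x \<le> d" "- g x \<le> d" using nn[of x] d(1) unfolding g_def by linarith+
    show "g x = d \<longleftrightarrow> x \<in> K"
      using nn[of x] d(1) d(2)[of x] zero(1)[of x] unfolding g_def by linarith
    show "- g x = d \<longleftrightarrow> x \<in> L"
      using nn[of x] d(1) d(3)[of x] zero(2)[of x] unfolding g_def by linarith
  qed
qed

text \<open>The midpoint of \<open>\<mu>\<close> and \<open>\<xi>\<close> would also have infinite
  entropy, so both it and \<open>\<mu>\<close> would attain the supremum. Uniqueness makes them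
  equal, which forces \<open>\<mu> = \<xi>\<close>.\<close>

lemma entropy_finite:
  assumes uniq: "\<exists>!\<nu>. equilibrium_state X f (\<lambda>_. 0) \<nu>" and \<xi>: "\<xi> \<in> MX" "metric_entropy X f \<xi> \<noteq> \<infinity>" and \<mu>: "\<mu> \<in> MX"
  shows "metric_entropy X f \<mu> < \<infinity>"
proof (rule ccontr)
  assume "\<not> ?thesis"
  then have inf: "metric_entropy X f \<mu> = \<infinity>" by simp
  obtain \<rho> where \<rho>: "\<rho> \<in> MX" "\<And>A. A \<in> sets BX \<Longrightarrow> measure \<rho> A = 1 / 2 * measure \<mu> A + (1 - 1 / 2) * measure \<xi> A"
    using midpoint_invariant[OF \<mu> \<xi>(1)] by blast
  have inf': "metric_entropy X f \<rho> = \<infinity>"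
    using metric_entropy_convex_combination_infinite[OF \<rho>(1) \<mu> \<xi>(1) _ _ \<rho>(2) inf] by simp
  have "equilibrium_state X f (\<lambda>_. 0) \<kappa>" if "\<kappa> \<in> MX" "metric_entropy X f \<kappa> = \<infinity>" for \<kappa>
  proof -
    have "metric_entropy X f \<kappa> + ereal (integral\<^sup>L \<kappa> (\<lambda>_. 0))
      \<le> (SUP \<mu>\<in>MX. metric_entropy X f \<mu> + ereal (integral\<^sup>L \<mu> (\<lambda>_. 0)))"
      using that(1) by (rule SUP_upper)
    then show ?thesis using that by (simp add: equilibrium_state_def)
  qed
  then have "\<rho> = \<mu>" using uniq \<mu> \<rho>(1) inf inf' by blast
  note I = invariantD[OF \<mu>] invariantD[OF \<xi>(1)]
  interpret \<mu>: prob_space \<mu> by (rule I)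
  interpret \<xi>: prob_space \<xi> by (rule I)
  have "\<mu> = \<xi>"
  proof (rule measure_eqI)
    fix A assume "A \<in> sets \<mu>"
    then have "measure \<mu> A = measure \<xi> A" using \<rho>(2)[of A] I \<open>\<rho> = \<mu>\<close> by simp
    then show "emeasure \<mu> A = emeasure \<xi> A" by (simp add: \<mu>.emeasure_eq_measure \<xi>.emeasure_eq_measure)
  qed (simp add: I)
  then show False using \<xi> inf by simp
qed

lemma equilibrium_state_strict_max:
  assumes fin: "\<And>\<mu>. \<mu> \<in> MX \<Longrightarrow> metric_entropy X f \<mu> < \<infinity>"
    and uniq: "\<exists>!\<nu>. equilibrium_state X f \<phi> \<nu>" and \<nu>: "equilibrium_state X f \<phi> \<nu>"
    and \<mu>: "\<mu> \<in> MX" "\<mu> \<noteq> \<nu>"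
  shows "real_entropy \<mu> + integral\<^sup>L \<mu> \<phi> < real_entropy \<nu> + integral\<^sup>L \<nu> \<phi>"
proof -
  let ?S = "SUP \<mu>\<in>MX. metric_entropy X f \<mu> + ereal (integral\<^sup>L \<mu> \<phi>)"
  have \<nu>M: "\<nu> \<in> MX" and S: "metric_entropy X f \<nu> + ereal (integral\<^sup>L \<nu> \<phi>) = ?S"
    using \<nu> by (auto simp: equilibrium_state_def)
  have le: "metric_entropy X f \<mu> + ereal (integral\<^sup>L \<mu> \<phi>) \<le> ?S" using \<mu>(1) by (rule SUP_upper)
  have "\<not> equilibrium_state X f \<phi> \<mu>" using uniq \<nu> \<mu>(2) by blast
  then have "metric_entropy X f \<mu> + ereal (integral\<^sup>L \<mu> \<phi>) \<noteq> ?S"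
    using \<mu>(1) by (simp add: equilibrium_state_def)
  then have "metric_entropy X f \<mu> + ereal (integral\<^sup>L \<mu> \<phi>) < metric_entropy X f \<nu> + ereal (integral\<^sup>L \<nu> \<phi>)"
    using le unfolding S by (rule le_neq_trans[rotated])
  then show ?thesis by (simp add: metric_entropy_eq_ereal[OF _ fin] \<mu>(1) \<nu>M)
qed

end

theorem theorem3p2:
  fixes X :: "'a::metric_space set" and f :: "'a \<Rightarrow> 'a"
  assumes cpt: "compact X"
    and fcont: "continuous_on X f" and fX: "f ` X \<subseteq> X"
    and H1: "\<And>\<mu>s \<mu>. (\<forall>n. \<mu>s n \<in> invariant_measures X f) \<Longrightarrow> \<mu> \<in> invariant_measures X f \<Longrightarrow>
               weak_star_conv X \<mu>s \<mu> \<Longrightarrow>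
               limsup (\<lambda>n. metric_entropy X f (\<mu>s n)) \<le> metric_entropy X f \<mu>"
    and H2: "\<And>\<phi> C. C-lipschitz_on X \<phi> \<Longrightarrow> \<exists>!\<nu>. equilibrium_state X f \<phi> \<nu>"
    and H3: "saturated X f"
    and H4: "\<exists>\<mu>1 \<mu>2. \<mu>1 \<noteq> \<mu>2 \<and> uniquely_ergodic X f \<mu>1 \<and> uniquely_ergodic X f \<mu>2 \<and>
               metric_entropy X f \<mu>1 = 0 \<and> metric_entropy X f \<mu>2 = 0"
    and mmax: "measure_of_maximal_entropy X f m"
    and L: "uniquely_ergodic X f \<mu>L" "metric_entropy X f \<mu>L = 0"
    and R: "uniquely_ergodic X f \<mu>R" "metric_entropy X f \<mu>R = 0"
    and LR: "\<mu>L \<noteq> \<mu>R"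
  shows "\<exists>\<nu>::real \<Rightarrow> 'a measure.
           (\<forall>t\<in>{-1..1}. \<nu> t \<in> ergodic_measures X f) \<and>
           weak_star_continuous_on {-1..1} X \<nu> \<and>
           \<nu> (-1) = \<mu>L \<and> \<nu> 0 = m \<and> \<nu> 1 = \<mu>R \<and>
           continuous_on {-1..1} (\<lambda>t. metric_entropy X f (\<nu> t)) \<and>
           mono_on {-1..0} (\<lambda>t. metric_entropy X f (\<nu> t)) \<and>
           antimono_on {0..1} (\<lambda>t. metric_entropy X f (\<nu> t)) \<and>
           \<nu> ` {-1..0} \<inter> \<nu> ` {0..1} = {m}"
proof -
  interpret compact_system X f using cpt fcont fX by (rule compact_system.intro)
  have L_inv: "\<mu>L \<in> MX" and R_inv: "\<mu>R \<in> MX" using L R by (simp_all add: uniquely_ergodic_def)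
  have cm: "compact (msupp X \<mu>)" for \<mu>
    using compact_Int_closed[OF cpt closed_msupp] msupp_subset by (metis inf.absorb2)
  have ne: "msupp X \<mu> \<noteq> {}" if "\<mu> \<in> MX" for \<mu>
    using emeasure_msupp(1) invariantD[OF that] by blast
  obtain g :: "'a \<Rightarrow> real" and d where gd: "2-lipschitz_on UNIV g \<and>
      (\<forall>x. g x \<le> d) \<and> (\<forall>x. g x = d \<longleftrightarrow> x \<in> msupp X \<mu>L) \<and>
      (\<forall>x. - g x \<le> d) \<and> (\<forall>x. - g x = d \<longleftrightarrow> x \<in> msupp X \<mu>R)"
    using separating_function[OF cm ne[OF L_inv] cm ne[OF R_inv] uniquely_ergodic_msupp_disjoint[OF L(1) R(1) LR]]
    by (elim exE) (rule that)
  then have lip: "2-lipschitz_on UNIV g"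
    and gL: "\<And>x. g x \<le> d" "\<And>x. g x = d \<longleftrightarrow> x \<in> msupp X \<mu>L"
    and gR: "\<And>x. - g x \<le> d" "\<And>x. - g x = d \<longleftrightarrow> x \<in> msupp X \<mu>R"
    by simp_all
  have g: "continuous_on X g" by (rule continuous_on_subset[OF lipschitz_on_continuous_on[OF lip] subset_UNIV])
  have peakL: "integral\<^sup>L \<mu> g < integral\<^sup>L \<mu>L g" if "\<mu> \<in> MX" "\<mu> \<noteq> \<mu>L" for \<mu>
    using uniquely_ergodic_peak[OF L(1) g gL] that by simp
  have peakR: "integral\<^sup>L \<mu>R g < integral\<^sup>L \<mu> g" if "\<mu> \<in> MX" "\<mu> \<noteq> \<mu>R" for \<mu>
  proof -
    have "continuous_on X (\<lambda>x. - g x)" by (intro continuous_intros g)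
    from uniquely_ergodic_peak[OF R(1) this gR] that
    show ?thesis by fastforce
  qed
  have lip_scaled: "(\<bar>c\<bar> * 2)-lipschitz_on X (\<lambda>x. c * g x)" for c
  proof (rule lipschitz_onI)
    fix x y
    have "\<bar>c\<bar> * \<bar>g x - g y\<bar> \<le> \<bar>c\<bar> * (2 * dist x y)"
      using lipschitz_onD[OF lip, of x y] by (intro mult_left_mono) (simp_all add: dist_real_def)
    then show "dist (c * g x) (c * g y) \<le> \<bar>c\<bar> * 2 * dist x y"
      by (simp add: dist_real_def abs_mult flip: right_diff_distrib)
  qed simp
  have uniq: "\<exists>!\<nu>. equilibrium_state X f (\<lambda>x. c * g x) \<nu>" for c using H2[OF lip_scaled] .
  have uniq0: "\<exists>!\<nu>. equilibrium_state X f (\<lambda>_. 0) \<nu>" using uniq[of 0] by simp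
  have fin: "metric_entropy X f \<mu> < \<infinity>" if "\<mu> \<in> MX" for \<mu>
    using entropy_finite[OF uniq0 L_inv _ that] L(2) by simp
  \<comment> \<open>For \<open>\<bar>t\<bar> < 1\<close>, \<open>J t\<close> divided by
    \<open>1 - \<bar>t\<bar>\<close> is the entropy plus the integral of \<open>c t * g\<close>; at
    \<open>t = 0\<close> the potential is zero, which yields \<open>m\<close>.\<close>
  define c where "c t = - t / (1 - \<bar>t\<bar>)" for t :: real
  \<comment> \<open>The two ends correspond to no finite potential and are prescribed; elsewhere
    \<open>uniq\<close> justifies \<open>THE\<close>.\<close>
  define N where "N t = (if t = -1 then \<mu>L else if t = 1 then \<mu>R
    else THE \<nu>. equilibrium_state X f (\<lambda>x. c t * g x) \<nu>)" for t
  have N_eq: "equilibrium_state X f (\<lambda>x. c t * g x) (N t)" if "t \<noteq> -1" "t \<noteq> 1" for t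
    using theI'[OF uniq[of "c t"]] that by (simp add: N_def)
  have N0: "N 0 = m"
    using N_eq[of 0] uniq0 mmax unfolding measure_of_maximal_entropy_def by (auto simp: c_def)
  interpret tilted_maximizers X f g N
  proof
    show "continuous_on X g" by (rule g)
    show "limsup (\<lambda>n. metric_entropy X f (\<mu>s n)) \<le> metric_entropy X f \<mu>"
      if "\<forall>n. \<mu>s n \<in> MX" "\<mu> \<in> MX" "weak_star_conv X \<mu>s \<mu>" for \<mu>s \<mu>
      using H1 that by blast
    show "metric_entropy X f \<mu> < \<infinity>" if "\<mu> \<in> MX" for \<mu> using fin that .
    show "N t \<in> MX" if "t \<in> {-1..1}" for t
      using N_eq[of t] L_inv R_inv by (auto simp: N_def equilibrium_state_def)
    show "real_entropy (N (- 1)) = 0" "real_entropy (N 1) = 0"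
      using L R by (simp_all add: N_def real_entropy_def)
    show "(1 - \<bar>t\<bar>) * real_entropy \<mu> - t * integral\<^sup>L \<mu> g < (1 - \<bar>t\<bar>) * real_entropy (N t) - t * integral\<^sup>L (N t) g"
      if t: "t \<in> {-1..1}" and \<mu>: "\<mu> \<in> MX" "\<mu> \<noteq> N t" for t \<mu>
    proof -
      \<comment> \<open>At the ends the functional is the integral of \<open>g\<close> or of
        \<open>- g\<close>, and strictness comes from the peaks on the supports; in between it comes
        from uniqueness of equilibrium states.\<close>
      consider "t = -1" | "t = 1" | "\<bar>t\<bar> < 1" using t by fastforce
      then show ?thesis
      proof cases
        case 1
        then show ?thesis using peakL[OF \<mu>(1)] \<mu>(2) by (simp add: N_def)
      next
        case 2
        then show ?thesis using peakR[OF \<mu>(1)] \<mu>(2) by (simp add: N_def)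
      next
        case 3
        then have "t \<noteq> -1" "t \<noteq> 1" by auto
        from equilibrium_state_strict_max[OF fin uniq N_eq[OF this] \<mu>]
        have "real_entropy \<mu> + c t * integral\<^sup>L \<mu> g < real_entropy (N t) + c t * integral\<^sup>L (N t) g" by simp
        then have "(1 - \<bar>t\<bar>) * (real_entropy \<mu> + c t * integral\<^sup>L \<mu> g)
          < (1 - \<bar>t\<bar>) * (real_entropy (N t) + c t * integral\<^sup>L (N t) g)"
          using 3 by (intro mult_strict_left_mono) auto
        moreover have "(1 - \<bar>t\<bar>) * (h + c t * i) = (1 - \<bar>t\<bar>) * h - t * i" for h i
          using 3 by (simp add: c_def field_simps)
        ultimately show ?thesis by simp
      qed
    qed
  qed
  have "N (-1) = \<mu>L" "N 1 = \<mu>R" by (simp_all add: N_def)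
  then show ?thesis
    using ergodic weak_star_continuous N0 entropy_continuous entropy_mono entropy_antimono halves_meet_only_at_0
    by (intro exI[of _ N]) simp
qed

end
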